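(* Let $\pi$ be a mean-zero, unit-variance probability distribution on $\mathbb{R}$ and let $\mathcal{X}=\mathrm{iid}(\pi/\sqrt n)$. Let $\lambda\ge 0$, $P_n=\mathrm{GWig}_n(0)$ and $Q_n=\mathrm{GWig}_n(\lambda,\mathcal{X})$. Suppose $\pi$ is $\sigma^2$-subgaussian for a constant $\sigma>0$, and suppose $\lambda<1/\sigma$. Let $\delta>0$ be a constant small enough that $\lambda<1/(\sigma(1+\delta))$, let $\tilde{\mathcal{X}}_n$ be the conditional distribution of $x\sim\mathcal{X}_n$ given the event $\|x\|\le 1+\delta$ (an event of probability $1-o(1)$), and let $\tilde Q_n=\mathrm{GWig}_n(\lambda,\tilde{\mathcal{X}})$. Then $$\lim_{n\to\infty}\mathbb{E}_{P_n}\left[\left(\frac{d\tilde Q_n}{dP_n}\right)^2\right]=(1-\lambda^2)^{-1/2}<\infty,$$ and consequently $Q_n$ is contiguous to $P_n$.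
   Context: A spike prior is a family $\mathcal{X}=\{\mathcal{X}_n\}$, where $\mathcal{X}_n$ is a probability distribution on $\mathbb{R}^n$ such that for $x\sim\mathcal{X}_n$, $\|x\|\to1$ in probability as $n\to\infty$. For a distribution $\pi$ on $\mathbb{R}$ with mean $0$ and variance $1$, $\mathrm{iid}(\pi/\sqrt n)$ denotes the spike prior under which the coordinates of $x\in\mathbb{R}^n$ are independent, each distributed as $\pi/\sqrt n$. Spiked Gaussian Wigner model: for $\lambda\ge0$ and a spike prior $\mathcal{X}$, $\mathrm{GWig}_n(\lambda,\mathcal{X})$ is the distribution of $Y=\lambda xx^\top+\frac1{\sqrt n}W$, where $x\sim\mathcal{X}_n$ and, independently, $W$ is an $n\times n$ symmetric matrix with off-diagonal entries $\mathcal{N}(0,1)$, diagonal entries $\mathcal{N}(0,2)$, all entries independent up to symmetry. $\mathrm{GWig}_n(0)$ is the case $\lambda=0$. A real random variable $X$ is $\sigma^2$-subgaussian if $\mathbb{E}X=0$ and $\mathbb{E}\exp(vX)\le\exp(\sigma^2v^2/2)$ for all $v\in\mathbb{R}$. A sequence of distributions $Q_n$ is contiguous to $P_n$ (on the same measurable spaces) if for every sequence of events $A_n$, $P_n(A_n)\to0$ implies $Q_n(A_n)\to0$. *)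

theory Defs
  imports "HOL-Probability.Probability"
begin

text \<open>Vectors in \<open>\<real>\<^sup>n\<close> are functions on \<open>{..<n}\<close>, and \<open>n \<times> n\<close> matrices are functions on
  \<open>{..<n} \<times> {..<n}\<close>, extended by \<^const>\<open>undefined\<close> outside the index set as required by
  \<^const>\<open>PiM\<close>.\<close>

abbreviation vec_space :: "nat \<Rightarrow> (nat \<Rightarrow> real) measure" where
  "vec_space n \<equiv> (\<Pi>\<^sub>M i\<in>{..<n}. borel)"

abbreviation mat_space :: "nat \<Rightarrow> (nat \<times> nat \<Rightarrow> real) measure" where
  "mat_space n \<equiv> (\<Pi>\<^sub>M ij\<in>{..<n} \<times> {..<n}. borel)"

definition iid_prior :: "real measure \<Rightarrow> nat \<Rightarrow> (nat \<Rightarrow> real) measure" where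
  "iid_prior \<pi> n = (\<Pi>\<^sub>M i\<in>{..<n}. distr \<pi> borel (\<lambda>t. t / sqrt (real n)))"

text \<open>If the event has probability zero, \<^const>\<open>uniform_measure\<close> is the null measure.\<close>

definition truncated_prior ::
    "real \<Rightarrow> (nat \<Rightarrow> (nat \<Rightarrow> real) measure) \<Rightarrow> nat \<Rightarrow> (nat \<Rightarrow> real) measure" where
  "truncated_prior r X n = uniform_measure (X n) {x \<in> space (X n). L2_set x {..<n} \<le> r}"

text \<open>The independent entries of \<open>W\<close> are those with row index at most the column index. The
  second parameter of \<^const>\<open>normal_density\<close> is the standard deviation, so the diagonal
  variance is 2.\<close>

definition upper_idx :: "nat \<Rightarrow> (nat \<times> nat) set" where
  "upper_idx n = {(i, j). i \<le> j \<and> j < n}"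

definition upper_entries :: "nat \<Rightarrow> (nat \<times> nat \<Rightarrow> real) measure" where
  "upper_entries n = (\<Pi>\<^sub>M ij\<in>upper_idx n.
     density lborel (normal_density 0 (if fst ij = snd ij then sqrt 2 else 1)))"

definition symmetrize :: "nat \<Rightarrow> (nat \<times> nat \<Rightarrow> real) \<Rightarrow> nat \<times> nat \<Rightarrow> real" where
  "symmetrize n g = (\<lambda>(i, j)\<in>{..<n} \<times> {..<n}. g (min i j, max i j))"

definition wigner_noise :: "nat \<Rightarrow> (nat \<times> nat \<Rightarrow> real) measure" where
  "wigner_noise n = distr (upper_entries n) (mat_space n) (symmetrize n)"

definition spiked_matrix ::
    "nat \<Rightarrow> real \<Rightarrow> (nat \<Rightarrow> real) \<times> (nat \<times> nat \<Rightarrow> real) \<Rightarrow> nat \<times> nat \<Rightarrow> real" where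
  "spiked_matrix n lam = (\<lambda>(x, W). \<lambda>(i, j)\<in>{..<n} \<times> {..<n}.
     lam * (x i * x j) + 1 / sqrt (real n) * W (i, j))"

definition GWig :: "nat \<Rightarrow> real \<Rightarrow> (nat \<Rightarrow> (nat \<Rightarrow> real) measure) \<Rightarrow> (nat \<times> nat \<Rightarrow> real) measure" where
  "GWig n lam X = distr (X n \<Otimes>\<^sub>M wigner_noise n) (mat_space n) (spiked_matrix n lam)"

definition GWig0 :: "nat \<Rightarrow> (nat \<times> nat \<Rightarrow> real) measure" where
  "GWig0 n = distr (wigner_noise n) (mat_space n)
     (\<lambda>W. \<lambda>ij\<in>{..<n} \<times> {..<n}. 1 / sqrt (real n) * W ij)"

text \<open>The integrability conjuncts rule out the convention that the Bochner integral of a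
  non-integrable function is zero.\<close>

definition subgaussian :: "'a measure \<Rightarrow> ('a \<Rightarrow> real) \<Rightarrow> real \<Rightarrow> bool" where
  "subgaussian M X s \<longleftrightarrow>
     integrable M X \<and> integral\<^sup>L M X = 0 \<and>
     (\<forall>v. integrable M (\<lambda>\<omega>. exp (v * X \<omega>)) \<and>
        integral\<^sup>L M (\<lambda>\<omega>. exp (v * X \<omega>)) \<le> exp (s * v\<^sup>2 / 2))"

definition contiguous :: "(nat \<Rightarrow> 'a measure) \<Rightarrow> (nat \<Rightarrow> 'a measure) \<Rightarrow> bool" where
  "contiguous Q P \<longleftrightarrow>
     (\<forall>n. sets (Q n) = sets (P n)) \<and>
     (\<forall>A. (\<forall>n. A n \<in> sets (P n)) \<longrightarrow> (\<lambda>n. measure (P n) (A n)) \<longlonglongrightarrow> 0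
        \<longrightarrow> (\<lambda>n. measure (Q n) (A n)) \<longlonglongrightarrow> 0)"

lemma sets_wigner_noise [simp, measurable_cong]: "sets (wigner_noise n) = sets (mat_space n)"
  unfolding wigner_noise_def by (rule sets_distr)

lemma sets_upper_entries [measurable_cong]:
  "sets (upper_entries n) = sets (\<Pi>\<^sub>M ij\<in>upper_idx n. (borel :: real measure))"
  unfolding upper_entries_def by (rule sets_PiM_cong) auto

lemma measurable_symmetrize [measurable]: "symmetrize n \<in> measurable (upper_entries n) (mat_space n)"
proof -
  have "(\<lambda>g. \<lambda>ij\<in>{..<n} \<times> {..<n}. g (min (fst ij) (snd ij), max (fst ij) (snd ij)))
      \<in> measurable (upper_entries n) (mat_space n)"
    unfolding measurable_cong_sets[OF sets_upper_entries refl]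
    by (rule measurable_restrict, rule measurable_component_singleton) (auto simp: upper_idx_def)
  thus ?thesis unfolding symmetrize_def case_prod_unfold .
qed

lemma prob_space_upper_entries: "prob_space (upper_entries n)"
  unfolding upper_entries_def
  by (intro prob_space_PiM prob_space_normal_density) auto

lemma prob_space_wigner_noise: "prob_space (wigner_noise n)"
  unfolding wigner_noise_def
  by (intro prob_space.prob_space_distr prob_space_upper_entries measurable_symmetrize)

lemma measurable_spiked_matrix [measurable]:
  "spiked_matrix n lam \<in> measurable (vec_space n \<Otimes>\<^sub>M mat_space n) (mat_space n)"
proof -
  have "(\<lambda>z. \<lambda>ij\<in>{..<n} \<times> {..<n}. lam * (fst z (fst ij) * fst z (snd ij)) + 1 / sqrt (real n) * snd z ij)
      \<in> measurable (vec_space n \<Otimes>\<^sub>M mat_space n) (mat_space n)"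
    by (rule measurable_restrict, simp add: mem_Times_iff, measurable)
  thus ?thesis unfolding spiked_matrix_def case_prod_unfold prod.collapse .
qed

lemma sets_iid_prior: "sets (iid_prior \<pi> n) = sets (vec_space n)"
  unfolding iid_prior_def by (rule sets_PiM_cong) auto

lemma prob_space_iid_prior:
  assumes "real_distribution \<pi>"
  shows "prob_space (iid_prior \<pi> n)"
proof -
  interpret real_distribution \<pi> by fact
  show ?thesis
    unfolding iid_prior_def by (intro prob_space_PiM prob_space_distr) simp
qed

lemma prob_space_GWig:
  assumes "prob_space (X n)" and sX: "sets (X n) = sets (vec_space n)"
  shows "prob_space (GWig n lam X)"
proof -
  interpret A: prob_space "X n" by fact
  interpret B: prob_space "wigner_noise n" by (rule prob_space_wigner_noise)
  interpret pair_prob_space "X n" "wigner_noise n" ..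
  note [measurable_cong] = sX
  show ?thesis unfolding GWig_def by (rule prob_space_distr) measurable
qed

text \<open>For \<open>\<lambda> = 0\<close> the spike prior is irrelevant.\<close>

lemma GWig_zero:
  assumes "prob_space (X n)" and sX: "sets (X n) = sets (vec_space n)"
  shows "GWig n 0 X = GWig0 n"
proof -
  interpret A: prob_space "X n" by fact
  interpret B: prob_space "wigner_noise n" by (rule prob_space_wigner_noise)
  interpret pair_prob_space "X n" "wigner_noise n" ..
  note [measurable_cong] = sX
  let ?s = "\<lambda>W. \<lambda>ij\<in>{..<n} \<times> {..<n}. 1 / sqrt (real n) * (W ij :: real)"
  have s: "?s \<in> measurable (mat_space n) (mat_space n)"
    by (rule measurable_restrict) measurable
  have "distr (X n \<Otimes>\<^sub>M wigner_noise n) (wigner_noise n) snd = wigner_noise n"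
  proof (rule measure_eqI)
    fix S assume "S \<in> sets (distr (X n \<Otimes>\<^sub>M wigner_noise n) (wigner_noise n) snd)"
    hence S: "S \<in> sets (wigner_noise n)" by simp
    have "snd -` S \<inter> space (X n \<Otimes>\<^sub>M wigner_noise n) = space (X n) \<times> S"
      using sets.sets_into_space[OF S] by (auto simp: space_pair_measure)
    with S show "emeasure (distr (X n \<Otimes>\<^sub>M wigner_noise n) (wigner_noise n) snd) S
        = emeasure (wigner_noise n) S"
      by (simp add: emeasure_distr B.emeasure_pair_measure_Times A.emeasure_space_1)
  qed simp
  hence "GWig0 n = distr (distr (X n \<Otimes>\<^sub>M wigner_noise n) (wigner_noise n) snd) (mat_space n) ?s"
    by (simp add: GWig0_def)
  also have "\<dots> = distr (X n \<Otimes>\<^sub>M wigner_noise n) (mat_space n) (?s \<circ> snd)"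
    by (rule distr_distr)
       (simp_all only: s measurable_snd measurable_cong_sets[OF sets_wigner_noise refl])
  also have "?s \<circ> snd = spiked_matrix n 0"
    by (auto simp: spiked_matrix_def fun_eq_iff restrict_def split: prod.splits)
  finally show ?thesis by (simp add: GWig_def)
qed

end

theory Submission
  imports Defs
begin

text \<open>Given the spike \<open>x\<close>, the law of the observed matrix is a shift of the noise law, so its
  likelihood ratio is explicit; averaging products of two such ratios over the noise gives the
  second moment \<open>E exp (n \<lambda>\<^sup>2 \<langle>x, y\<rangle>\<^sup>2 / 2)\<close> for independent copies \<open>x, y\<close> of the truncated spike. By the
  central limit theorem \<open>sqrt n \<langle>x, y\<rangle>\<close> is asymptotically standard Gaussian \<open>g\<close>, and
  \<open>E exp (\<lambda>\<^sup>2 g\<^sup>2 / 2) = (1 - \<lambda>\<^sup>2) powr (- 1 / 2)\<close>. Passing to the limit under the exponential needs uniform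
  integrability: for \<open>\<mu>\<close> slightly above \<open>\<lambda>\<close> and \<open>\<parallel>y\<parallel> \<le> 1 + \<delta>\<close>, subgaussianity bounds
  \<open>E exp (n \<mu>\<^sup>2 \<langle>x, y\<rangle>\<^sup>2 / 2)\<close> uniformly in \<open>n\<close>. A bounded second moment of the likelihood ratio,
  together with the negligible mass removed by the truncation, yields contiguity.\<close>

subsection \<open>Gaussian likelihood ratios\<close>

text \<open>Large norms force the truncation. For fixed \<open>y\<close> the subgaussian bound is
  \<open>1 / sqrt (1 - (\<mu> * \<sigma> * \<parallel>y\<parallel>)\<^sup>2)\<close>, which breaks
  down at \<parallel>y\<parallel> = 1 / (\<mu> * \<sigma>). Already for Gaussian \<pi> and
  \<open>lam > 0\<close> the untruncated second moment is infinite at every positive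
  \<open>n\<close>, because of rare \<open>y\<close> of large norm. The assumption
  \<open>lam < 1 / (\<sigma> * (1 + \<delta>))\<close> leaves the gap in which \<mu> is chosen, and
  truncating one of the two copies is enough for the estimate.

  The Gaussian limit asks for a different threshold, \<open>lam < 1\<close>. It follows from
  \<open>lam < 1 / \<sigma>\<close> because a unit-variance law has no variance proxy below 1, that
  is, \<sigma> \<ge> 1.

  The limit is computed for the unnormalised truncated integral; the squared probability of the
  truncation event, which tends to 1, is divided out at the end.\<close>

lemma nn_integral_normal_density:
  "0 < s \<Longrightarrow> (\<integral>\<^sup>+x. ennreal (normal_density m s x) \<partial>lborel) = 1"
  by (subst nn_integral_eq_integral) auto

text \<open>Completing the square: tilting by \<open>exp (a * x)\<close> moves the mean to
  \<open>a * s\<^sup>2\<close> and leaves the stated constant. Read from right to left, this is what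
  linearises a square in an exponent.\<close>

lemma nn_integral_gaussian_exp:
  assumes "0 < s"
  shows "(\<integral>\<^sup>+x. ennreal (exp (a * x)) \<partial>density lborel (normal_density 0 s)) = ennreal (exp (a\<^sup>2 * s\<^sup>2 / 2))"
proof -
  have eq: "normal_density 0 s x * exp (a * x) = exp (a\<^sup>2 * s\<^sup>2 / 2) * normal_density (a * s\<^sup>2) s x" for x
  proof -
    have "- x\<^sup>2 / (2 * s\<^sup>2) + a * x = a\<^sup>2 * s\<^sup>2 / 2 + - (x - a * s\<^sup>2)\<^sup>2 / (2 * s\<^sup>2)"
      using assms by (simp add: field_simps power2_eq_square)
    hence "exp (- x\<^sup>2 / (2 * s\<^sup>2)) * exp (a * x) = exp (a\<^sup>2 * s\<^sup>2 / 2) * exp (- (x - a * s\<^sup>2)\<^sup>2 / (2 * s\<^sup>2))"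
      by (simp only: exp_add [symmetric])
    thus ?thesis by (simp add: normal_density_def)
  qed
  have "(\<integral>\<^sup>+x. ennreal (exp (a * x)) \<partial>density lborel (normal_density 0 s))
      = (\<integral>\<^sup>+x. ennreal (exp (a\<^sup>2 * s\<^sup>2 / 2)) * ennreal (normal_density (a * s\<^sup>2) s x) \<partial>lborel)"
    by (subst nn_integral_density) (auto simp: ennreal_mult[symmetric] eq intro!: nn_integral_cong)
  thus ?thesis
    using assms by (simp add: nn_integral_cmult nn_integral_normal_density)
qed

text \<open>The tilted density is again Gaussian up to the factor \<open>s\<close>, with variance 1
  / (1 - c), which is why \<open>c < 1\<close> is required. With c = lam^2 this gives the limiting
  second moment, with c = (\<mu> * \<sigma> * r)^2 the uniform bound.\<close>

lemma nn_integral_std_gaussian_exp_square: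
  assumes "c < 1"
  shows "(\<integral>\<^sup>+x. ennreal (exp (c * x\<^sup>2 / 2)) \<partial>density lborel std_normal_density) = ennreal (1 / sqrt (1 - c))"
proof -
  define s where "s = 1 / sqrt (1 - c)"
  have s: "0 < s" "s\<^sup>2 = 1 / (1 - c)" using assms by (auto simp: s_def power_divide)
  have eq: "std_normal_density x * exp (c * x\<^sup>2 / 2) = s * normal_density 0 s x" for x
  proof -
    have "- x\<^sup>2 / 2 + c * x\<^sup>2 / 2 = - x\<^sup>2 / (2 * s\<^sup>2)"
      unfolding s using assms by (simp add: field_simps)
    hence "exp (- x\<^sup>2 / 2) * exp (c * x\<^sup>2 / 2) = exp (- x\<^sup>2 / (2 * s\<^sup>2))"
      by (simp only: exp_add [symmetric])
    moreover have "sqrt (2 * pi * s\<^sup>2) = sqrt (2 * pi) * s"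
      using s(1) by (simp add: real_sqrt_mult)
    ultimately show ?thesis
      using s(1) by (simp add: normal_density_def)
  qed
  have "(\<integral>\<^sup>+x. ennreal (exp (c * x\<^sup>2 / 2)) \<partial>density lborel std_normal_density)
      = (\<integral>\<^sup>+x. ennreal s * ennreal (normal_density 0 s x) \<partial>lborel)"
    using s(1)
    by (subst nn_integral_density) (auto simp: ennreal_mult[symmetric] eq intro!: nn_integral_cong)
  thus ?thesis
    using s(1) by (simp add: nn_integral_cmult nn_integral_normal_density s_def)
qed

text \<open>The density of the normal law with mean \<open>h\<close> and deviation \<open>s\<close>
  relative to the centred one with the same deviation.\<close>

definition gaussian_ratio :: "real \<Rightarrow> real \<Rightarrow> real \<Rightarrow> real" where
  "gaussian_ratio s h x = exp (h * x / s\<^sup>2 - h\<^sup>2 / (2 * s\<^sup>2))"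

lemma borel_measurable_gaussian_ratio [measurable (raw)]:
  assumes [measurable]: "f \<in> borel_measurable M" "g \<in> borel_measurable M"
  shows "(\<lambda>x. gaussian_ratio s (f x) (g x)) \<in> borel_measurable M"
  unfolding gaussian_ratio_def by measurable

lemma distr_gaussian_shift:
  assumes "0 < s"
  shows "distr (density lborel (normal_density 0 s)) borel (\<lambda>x. x + h)
    = density (density lborel (normal_density 0 s)) (gaussian_ratio s h)"
proof -
  let ?N = "density lborel (normal_density 0 s)"
  interpret prob_space ?N using assms by (rule prob_space_normal_density)
  have m: "gaussian_ratio s h \<in> borel_measurable borel"
    by measurable
  have "distributed ?N lborel (\<lambda>x. x) (normal_density 0 s)"
    unfolding distributed_def by (auto intro!: measure_eqI simp: emeasure_distr)
  from normal_density_affine[OF this assms, of 1 h]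
  have "distributed ?N lborel (\<lambda>x. x + h) (normal_density h s)"
    by (simp add: add.commute)
  hence "distr ?N lborel (\<lambda>x. x + h) = density lborel (normal_density h s)"
    by (simp add: distributed_def)
  moreover have "distr ?N lborel (\<lambda>x. x + h) = distr ?N borel (\<lambda>x. x + h)"
    by (intro distr_cong) auto
  moreover have "normal_density 0 s x * gaussian_ratio s h x = normal_density h s x" for x
  proof -
    have "- x\<^sup>2 / (2 * s\<^sup>2) + (h * x / s\<^sup>2 - h\<^sup>2 / (2 * s\<^sup>2)) = - (x - h)\<^sup>2 / (2 * s\<^sup>2)"
      using assms by (simp add: field_simps power2_eq_square)
    hence "exp (- x\<^sup>2 / (2 * s\<^sup>2)) * gaussian_ratio s h x = exp (- (x - h)\<^sup>2 / (2 * s\<^sup>2))"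
      unfolding gaussian_ratio_def by (simp only: exp_add [symmetric])
    thus ?thesis by (simp add: normal_density_def)
  qed
  ultimately show ?thesis
    using m by (subst density_density_eq) (auto simp: gaussian_ratio_def ennreal_mult'[symmetric])
qed

text \<open>In (h + k)^2 - h^2 - k^2 only the cross term 2 h k survives, so the correlation of two
  likelihood ratios depends on the product of the shifts alone.\<close>

lemma nn_integral_gaussian_ratio_mult:
  assumes "0 < s"
  shows "(\<integral>\<^sup>+x. ennreal (gaussian_ratio s h x * gaussian_ratio s k x) \<partial>density lborel (normal_density 0 s))
    = ennreal (exp (h * k / s\<^sup>2))"
proof -
  let ?c = "exp (- (h\<^sup>2 + k\<^sup>2) / (2 * s\<^sup>2))"
  have eq: "gaussian_ratio s h x * gaussian_ratio s k x = ?c * exp ((h + k) / s\<^sup>2 * x)" for x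
    unfolding gaussian_ratio_def exp_add[symmetric]
    using assms by (simp add: field_simps)
  have "(\<integral>\<^sup>+x. ennreal (gaussian_ratio s h x * gaussian_ratio s k x) \<partial>density lborel (normal_density 0 s))
     = ennreal ?c * ennreal (exp (((h + k) / s\<^sup>2)\<^sup>2 * s\<^sup>2 / 2))"
    unfolding eq nn_integral_gaussian_exp[OF assms, symmetric]
    by (subst nn_integral_cmult[symmetric]) (auto simp: ennreal_mult)
  also have "\<dots> = ennreal (exp (- (h\<^sup>2 + k\<^sup>2) / (2 * s\<^sup>2) + ((h + k) / s\<^sup>2)\<^sup>2 * s\<^sup>2 / 2))"
    by (simp add: ennreal_mult[symmetric] exp_add)
  also have "- (h\<^sup>2 + k\<^sup>2) / (2 * s\<^sup>2) + ((h + k) / s\<^sup>2)\<^sup>2 * s\<^sup>2 / 2 = h * k / s\<^sup>2"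
    using assms by (simp add: field_simps power2_eq_square)
  finally show ?thesis .
qed

text \<open>Both sides are identified with the product \<open>Pi\<^sub>M I ?N'\<close> of the
  one-dimensional shifted laws by comparing values on boxes. Positivity of \<open>s\<close> is asked
  at every index because \<open>product_sigma_finite\<close> speaks of the whole family.\<close>

lemma distr_PiM_gaussian_shift:
  fixes I :: "'i set" and s h :: "'i \<Rightarrow> real"
  assumes I: "finite I" and s: "\<And>i. 0 < s i"
  shows "distr (\<Pi>\<^sub>M i\<in>I. density lborel (normal_density 0 (s i))) (\<Pi>\<^sub>M i\<in>I. borel) (\<lambda>g. \<lambda>i\<in>I. g i + h i)
    = density (\<Pi>\<^sub>M i\<in>I. density lborel (normal_density 0 (s i)))
        (\<lambda>g. \<Prod>i\<in>I. ennreal (gaussian_ratio (s i) (h i) (g i)))"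
proof -
  let ?N = "\<lambda>i. density lborel (normal_density 0 (s i))"
  let ?N' = "\<lambda>i. density (?N i) (gaussian_ratio (s i) (h i))"
  let ?P = "\<Pi>\<^sub>M i\<in>I. ?N i"
  have N: "prob_space (?N i)" for i by (rule prob_space_normal_density) (rule s)
  have N': "prob_space (?N' i)" for i
    unfolding distr_gaussian_shift[OF s, symmetric]
    by (rule prob_space.prob_space_distr[OF N]) simp
  interpret N: product_sigma_finite ?N
    by standard (metis N prob_space_imp_sigma_finite sigma_finite_measure.sigma_finite_countable)
  interpret N': product_sigma_finite ?N'
    by standard (metis N' prob_space_imp_sigma_finite sigma_finite_measure.sigma_finite_countable)
  have setsP: "sets ?P = sets (\<Pi>\<^sub>M i\<in>I. (borel :: real measure))"
    by (rule sets_PiM_cong) auto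
  have setsN': "sets (Pi\<^sub>M I ?N') = sets (\<Pi>\<^sub>M i\<in>I. (borel :: real measure))"
    by (rule sets_PiM_cong) auto
  note [measurable_cong] = setsP
  have "distr ?P (\<Pi>\<^sub>M i\<in>I. borel) (\<lambda>g. \<lambda>i\<in>I. g i + h i) = Pi\<^sub>M I ?N'"
  proof (rule N'.PiM_eqI[OF I])
    fix A assume A: "\<And>i. i \<in> I \<Longrightarrow> A i \<in> sets (?N' i)"
    hence [measurable]: "i \<in> I \<Longrightarrow> A i \<in> sets borel" for i by simp
    have "(\<lambda>g. \<lambda>i\<in>I. g i + h i) -` Pi\<^sub>E I A \<inter> space ?P = (\<Pi>\<^sub>E i\<in>I. (\<lambda>x. x + h i) -` A i)"
      by (auto simp: space_PiM PiE_iff)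
    moreover have "Pi\<^sub>E I A \<in> sets (\<Pi>\<^sub>M i\<in>I. (borel :: real measure))"
      using I by (intro sets_PiM_I_finite) auto
    ultimately have "emeasure (distr ?P (\<Pi>\<^sub>M i\<in>I. borel) (\<lambda>g. \<lambda>i\<in>I. g i + h i)) (Pi\<^sub>E I A)
        = emeasure ?P (\<Pi>\<^sub>E i\<in>I. (\<lambda>x. x + h i) -` A i)"
      by (subst emeasure_distr) auto
    also have "\<dots> = (\<Prod>i\<in>I. emeasure (?N i) ((\<lambda>x. x + h i) -` A i))"
      using I by (intro N.emeasure_PiM) (auto intro: measurable_sets_borel[of _ borel, simplified])
    also have "\<dots> = (\<Prod>i\<in>I. emeasure (?N' i) (A i))"
      using A by (intro prod.cong refl) (simp add: distr_gaussian_shift[OF s, symmetric] emeasure_distr)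
    finally show "emeasure (distr ?P (\<Pi>\<^sub>M i\<in>I. borel) (\<lambda>g. \<lambda>i\<in>I. g i + h i)) (Pi\<^sub>E I A)
        = (\<Prod>i\<in>I. emeasure (?N' i) (A i))" .
  qed (use setsN' in simp)
  also have "Pi\<^sub>M I ?N' = density ?P (\<lambda>g. \<Prod>i\<in>I. ennreal (gaussian_ratio (s i) (h i) (g i)))"
  proof (rule sym, rule N'.PiM_eqI[OF I])
    fix A assume A: "\<And>i. i \<in> I \<Longrightarrow> A i \<in> sets (?N' i)"
    have "Pi\<^sub>E I A \<in> sets ?P"
      using I A by (intro sets_PiM_I_finite) auto
    hence "emeasure (density ?P (\<lambda>g. \<Prod>i\<in>I. ennreal (gaussian_ratio (s i) (h i) (g i)))) (Pi\<^sub>E I A)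
        = (\<integral>\<^sup>+g. (\<Prod>i\<in>I. ennreal (gaussian_ratio (s i) (h i) (g i))) * indicator (Pi\<^sub>E I A) g \<partial>?P)"
      by (subst emeasure_density) auto
    also have "\<dots> = (\<integral>\<^sup>+g. (\<Prod>i\<in>I. ennreal (gaussian_ratio (s i) (h i) (g i)) * indicator (A i) (g i)) \<partial>?P)"
    proof (rule nn_integral_cong)
      fix g assume g: "g \<in> space ?P"
      have "indicator (Pi\<^sub>E I A) g = (\<Prod>i\<in>I. indicator (A i) (g i) :: ennreal)"
        using g I by (auto simp: space_PiM PiE_iff indicator_def prod_zero_iff)
      thus "(\<Prod>i\<in>I. ennreal (gaussian_ratio (s i) (h i) (g i))) * indicator (Pi\<^sub>E I A) g
          = (\<Prod>i\<in>I. ennreal (gaussian_ratio (s i) (h i) (g i)) * indicator (A i) (g i))"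
        by (simp add: prod.distrib)
    qed
    also have "\<dots> = (\<Prod>i\<in>I. \<integral>\<^sup>+x. ennreal (gaussian_ratio (s i) (h i) x) * indicator (A i) x \<partial>?N i)"
      using I A by (intro N.product_nn_integral_prod) auto
    also have "\<dots> = (\<Prod>i\<in>I. emeasure (?N' i) (A i))"
      using A by (intro prod.cong refl) (simp add: emeasure_density)
    finally show "emeasure (density ?P (\<lambda>g. \<Prod>i\<in>I. ennreal (gaussian_ratio (s i) (h i) (g i)))) (Pi\<^sub>E I A)
        = (\<Prod>i\<in>I. emeasure (?N' i) (A i))" .
  qed (use setsN' setsP in simp)
  finally show ?thesis .
qed

lemma nn_integral_PiM_gaussian_ratio_mult:
  fixes I :: "'i set" and s h k :: "'i \<Rightarrow> real"
  assumes I: "finite I" and s: "\<And>i. 0 < s i"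
  shows "(\<integral>\<^sup>+g. (\<Prod>i\<in>I. ennreal (gaussian_ratio (s i) (h i) (g i))) * (\<Prod>i\<in>I. ennreal (gaussian_ratio (s i) (k i) (g i)))
      \<partial>(\<Pi>\<^sub>M i\<in>I. density lborel (normal_density 0 (s i)))) = ennreal (exp (\<Sum>i\<in>I. h i * k i / (s i)\<^sup>2))"
proof -
  let ?N = "\<lambda>i. density lborel (normal_density 0 (s i))"
  have N: "prob_space (?N i)" for i by (rule prob_space_normal_density) (rule s)
  interpret N: product_sigma_finite ?N
    by standard (metis N prob_space_imp_sigma_finite sigma_finite_measure.sigma_finite_countable)
  have "(\<integral>\<^sup>+g. (\<Prod>i\<in>I. ennreal (gaussian_ratio (s i) (h i) (g i))) * (\<Prod>i\<in>I. ennreal (gaussian_ratio (s i) (k i) (g i))) \<partial>(Pi\<^sub>M I ?N))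
     = (\<integral>\<^sup>+g. (\<Prod>i\<in>I. ennreal (gaussian_ratio (s i) (h i) (g i) * gaussian_ratio (s i) (k i) (g i))) \<partial>(Pi\<^sub>M I ?N))"
    by (simp add: prod.distrib[symmetric] ennreal_mult gaussian_ratio_def)
  also have "\<dots> = (\<Prod>i\<in>I. \<integral>\<^sup>+x. ennreal (gaussian_ratio (s i) (h i) x * gaussian_ratio (s i) (k i) x) \<partial>?N i)"
    using I by (intro N.product_nn_integral_prod) (auto simp: gaussian_ratio_def)
  also have "\<dots> = (\<Prod>i\<in>I. ennreal (exp (h i * k i / (s i)\<^sup>2)))"
    by (simp only: nn_integral_gaussian_ratio_mult[OF s])
  also have "\<dots> = ennreal (exp (\<Sum>i\<in>I. h i * k i / (s i)\<^sup>2))"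
    using I by (simp add: prod_ennreal exp_sum)
  finally show ?thesis .
qed

subsection \<open>The likelihood ratio of the spiked model\<close>

abbreviation entry_sd :: "nat \<times> nat \<Rightarrow> real" where
  "entry_sd ij \<equiv> (if fst ij = snd ij then sqrt 2 else 1)"

lemma upper_idx_subset: "upper_idx n \<subseteq> {..<n} \<times> {..<n}"
  by (auto simp: upper_idx_def)

lemma finite_upper_idx [simp]: "finite (upper_idx n)"
  using upper_idx_subset by (rule finite_subset) simp

text \<open>The square of the sum counts each off-diagonal pair twice and each diagonal term once.
  Dividing the diagonal by its variance 2 makes the upper triangle exactly half of it; this is what
  the diagonal variance of the noise is good for. The induction adds the last column.\<close>

lemma sum_upper_idx_eq_square:
  fixes a :: "nat \<Rightarrow> real"
  shows "(\<Sum>ij\<in>upper_idx n. a (fst ij) * a (snd ij) / (entry_sd ij)\<^sup>2) = (\<Sum>i<n. a i)\<^sup>2 / 2"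
proof (induction n)
  case 0
  show ?case by (simp add: upper_idx_def)
next
  case (Suc n)
  have split: "upper_idx (Suc n) = upper_idx n \<union> (\<lambda>i. (i, n)) ` {..n}"
    by (auto simp: upper_idx_def image_iff less_Suc_eq)
  have "(\<Sum>ij\<in>upper_idx (Suc n). a (fst ij) * a (snd ij) / (entry_sd ij)\<^sup>2)
      = (\<Sum>i<n. a i)\<^sup>2 / 2 + (\<Sum>ij\<in>(\<lambda>i. (i, n)) ` {..n}. a (fst ij) * a (snd ij) / (entry_sd ij)\<^sup>2)"
  proof -
    have "upper_idx n \<inter> (\<lambda>i. (i, n)) ` {..n} = {}"
      by (auto simp: upper_idx_def)
    thus ?thesis
      unfolding split by (simp add: sum.union_disjoint Suc.IH)
  qed
  also have "(\<Sum>ij\<in>(\<lambda>i. (i, n)) ` {..n}. a (fst ij) * a (snd ij) / (entry_sd ij)\<^sup>2)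
      = (\<Sum>i\<le>n. a i * a n / (if i = n then sqrt 2 else 1)\<^sup>2)"
    by (subst sum.reindex) (auto simp: inj_on_def)
  also have "\<dots> = (\<Sum>i<n. a i) * a n + (a n)\<^sup>2 / 2"
    by (simp add: lessThan_Suc_atMost[symmetric] sum_distrib_right power2_eq_square)
  finally show ?case
    by (simp add: power2_eq_square field_simps)
qed

text \<open>One map from the independent entries to the observed matrix; the null model and the
  spiked model are its images of the original and of the shifted entries.\<close>

definition noise_matrix :: "nat \<Rightarrow> (nat \<times> nat \<Rightarrow> real) \<Rightarrow> nat \<times> nat \<Rightarrow> real" where
  "noise_matrix n g = (\<lambda>ij\<in>{..<n} \<times> {..<n}. 1 / sqrt (real n) * symmetrize n g ij)"

lemma measurable_scale_matrix [measurable]: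
  "(\<lambda>W. \<lambda>ij\<in>{..<n} \<times> {..<n}. c * W ij) \<in> measurable (mat_space n) (mat_space n)"
  for c :: real
  by (rule measurable_restrict) measurable

lemma measurable_noise_matrix [measurable]: "noise_matrix n \<in> measurable (upper_entries n) (mat_space n)"
  unfolding noise_matrix_def[abs_def]
  using measurable_compose[OF measurable_symmetrize measurable_scale_matrix] .

lemma GWig0_eq_distr: "GWig0 n = distr (upper_entries n) (mat_space n) (noise_matrix n)"
  unfolding GWig0_def wigner_noise_def
  by (subst distr_distr) (auto simp: noise_matrix_def[abs_def] comp_def)

lemma sets_GWig0 [simp, measurable_cong]: "sets (GWig0 n) = sets (mat_space n)"
  by (simp add: GWig0_def)

lemma sets_GWig [simp, measurable_cong]: "sets (GWig n lam X) = sets (mat_space n)"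
  by (simp add: GWig_def)

lemma prob_space_GWig0: "prob_space (GWig0 n)"
  unfolding GWig0_eq_distr
  by (rule prob_space.prob_space_distr[OF prob_space_upper_entries]) measurable

text \<open>The mean of an entry measured in the scale of the noise before division by
  \<open>sqrt (real n)\<close>.\<close>

definition spike_shift :: "nat \<Rightarrow> real \<Rightarrow> (nat \<Rightarrow> real) \<Rightarrow> nat \<times> nat \<Rightarrow> real" where
  "spike_shift n lam x ij = lam * sqrt (real n) * (x (fst ij) * x (snd ij))"

text \<open>The likelihood ratio of the model with known spike \<open>x\<close>. Only the upper
  triangle of \<open>Y\<close> is read, since it holds all independent entries, and the factor
  \<open>sqrt (real n)\<close> undoes the scaling of the noise.\<close>

definition spike_ratio :: "nat \<Rightarrow> real \<Rightarrow> (nat \<Rightarrow> real) \<Rightarrow> (nat \<times> nat \<Rightarrow> real) \<Rightarrow> ennreal" where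
  "spike_ratio n lam x Y =
     (\<Prod>ij\<in>upper_idx n. ennreal (gaussian_ratio (entry_sd ij) (spike_shift n lam x ij) (sqrt (real n) * Y ij)))"

lemma measurable_spike_ratio [measurable]:
  "(\<lambda>(x, Y). spike_ratio n lam x Y) \<in> borel_measurable (vec_space n \<Otimes>\<^sub>M mat_space n)"
proof -
  have "(\<lambda>z. ennreal (gaussian_ratio (entry_sd ij) (spike_shift n lam (fst z) ij) (sqrt (real n) * snd z ij)))
      \<in> borel_measurable (vec_space n \<Otimes>\<^sub>M mat_space n)" if "ij \<in> upper_idx n" for ij
  proof -
    have ij: "fst ij \<in> {..<n}" "snd ij \<in> {..<n}" "ij \<in> {..<n} \<times> {..<n}"
      using that by (auto simp: upper_idx_def)
    note [measurable] = measurable_compose[OF measurable_fst measurable_component_singleton[OF ij(1)]]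
      measurable_compose[OF measurable_fst measurable_component_singleton[OF ij(2)]]
      measurable_compose[OF measurable_snd measurable_component_singleton[OF ij(3)]]
    show ?thesis
      unfolding spike_shift_def
      by (intro measurable_compose[OF _ measurable_ennreal] borel_measurable_gaussian_ratio) measurable
  qed
  thus ?thesis
    unfolding spike_ratio_def case_prod_unfold by (rule borel_measurable_prod_ennreal)
qed

lemma measurable_spike_ratio' [measurable]: "spike_ratio n lam x \<in> borel_measurable (mat_space n)"
proof -
  have "(\<lambda>Y. ennreal (gaussian_ratio (entry_sd ij) (spike_shift n lam x ij) (sqrt (real n) * Y ij)))
      \<in> borel_measurable (mat_space n)" if "ij \<in> upper_idx n" for ij
  proof -
    have [measurable]: "ij \<in> {..<n} \<times> {..<n}"
      using that by (auto simp: upper_idx_def)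
    show ?thesis
      by (intro measurable_compose[OF _ measurable_ennreal] borel_measurable_gaussian_ratio) measurable
  qed
  thus ?thesis
    unfolding spike_ratio_def[abs_def] by (rule borel_measurable_prod_ennreal)
qed

lemma spike_ratio_noise_matrix:
  "spike_ratio n lam x (noise_matrix n g)
    = (\<Prod>ij\<in>upper_idx n. ennreal (gaussian_ratio (entry_sd ij) (spike_shift n lam x ij) (g ij)))"
  unfolding spike_ratio_def
proof (intro prod.cong refl)
  fix ij assume ij: "ij \<in> upper_idx n"
  hence "sqrt (real n) * noise_matrix n g ij = g ij"
    by (auto simp: noise_matrix_def symmetrize_def upper_idx_def min_def max_def)
  thus "ennreal (gaussian_ratio (entry_sd ij) (spike_shift n lam x ij) (sqrt (real n) * noise_matrix n g ij))
      = ennreal (gaussian_ratio (entry_sd ij) (spike_shift n lam x ij) (g ij))" by simp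
qed

text \<open>The spike is symmetric, so adding it to the observed matrix amounts to shifting the
  independent entries before they are symmetrised and scaled. The resulting density depends on these
  entries only through the observed matrix, hence \<open>density_distr\<close> carries it
  over.\<close>

lemma distr_spiked_matrix:
  "distr (wigner_noise n) (mat_space n) (\<lambda>W. spiked_matrix n lam (x, W))
    = density (GWig0 n) (spike_ratio n lam x)"
proof -
  let ?U = "upper_entries n" and ?B = "\<Pi>\<^sub>M ij\<in>upper_idx n. (borel :: real measure)"
  let ?shift = "\<lambda>g. \<lambda>ij\<in>upper_idx n. g ij + spike_shift n lam x ij"
  have spk: "(\<lambda>W. spiked_matrix n lam (x, W)) \<in> measurable (mat_space n) (mat_space n)"
  proof -
    have "(\<lambda>W. \<lambda>ij\<in>{..<n} \<times> {..<n}. lam * (x (fst ij) * x (snd ij)) + 1 / sqrt (real n) * W ij)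
        \<in> measurable (mat_space n) (mat_space n)"
      by (rule measurable_restrict) measurable
    thus ?thesis by (simp add: spiked_matrix_def case_prod_unfold)
  qed
  have shift: "?shift \<in> measurable ?U ?B"
    unfolding measurable_cong_sets[OF sets_upper_entries refl]
    by (rule measurable_restrict) measurable
  have nm: "noise_matrix n \<in> measurable ?B (mat_space n)"
    using measurable_noise_matrix unfolding measurable_cong_sets[OF sets_upper_entries refl] .
  have eq: "spiked_matrix n lam (x, symmetrize n g) = noise_matrix n (?shift g)" for g
  proof (rule ext)
    fix ij :: "nat \<times> nat"
    obtain i j where ij: "ij = (i, j)" by (cases ij)
    show "spiked_matrix n lam (x, symmetrize n g) ij = noise_matrix n (?shift g) ij"
    proof (cases "i < n \<and> j < n")
      case True
      hence "real n > 0" by linarith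
      with True show ?thesis
        by (auto simp: ij spiked_matrix_def symmetrize_def noise_matrix_def upper_idx_def
            spike_shift_def min_def max_def field_simps)
    qed (auto simp: ij spiked_matrix_def noise_matrix_def)
  qed
  have "distr (wigner_noise n) (mat_space n) (\<lambda>W. spiked_matrix n lam (x, W))
      = distr ?U (mat_space n) (\<lambda>g. spiked_matrix n lam (x, symmetrize n g))"
    unfolding wigner_noise_def by (subst distr_distr[OF spk measurable_symmetrize]) (simp add: comp_def)
  also have "\<dots> = distr (distr ?U ?B ?shift) (mat_space n) (noise_matrix n)"
    by (subst distr_distr[OF nm shift]) (simp add: comp_def eq)
  also have "distr ?U ?B ?shift = density ?U
      (\<lambda>g. \<Prod>ij\<in>upper_idx n. ennreal (gaussian_ratio (entry_sd ij) (spike_shift n lam x ij) (g ij)))"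
    unfolding upper_entries_def by (rule distr_PiM_gaussian_shift) auto
  also have "\<dots> = density ?U (\<lambda>g. spike_ratio n lam x (noise_matrix n g))"
    by (simp only: spike_ratio_noise_matrix)
  also have "distr \<dots> (mat_space n) (noise_matrix n) = density (GWig0 n) (spike_ratio n lam x)"
    unfolding GWig0_eq_distr by (rule density_distr[symmetric]) measurable
  finally show ?thesis .
qed

text \<open>Slicing the product measure along the spike uses sigma-finiteness of the noise only, so
  the formula also covers a truncated prior that is the null measure.\<close>

lemma emeasure_GWig:
  assumes sX: "sets (X n) = sets (vec_space n)" and A [measurable]: "A \<in> sets (mat_space n)"
  shows "emeasure (GWig n lam X) A
    = (\<integral>\<^sup>+x. (\<integral>\<^sup>+Y. spike_ratio n lam x Y * indicator A Y \<partial>GWig0 n) \<partial>X n)"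
proof -
  note [measurable_cong] = sX
  interpret W: prob_space "wigner_noise n" by (rule prob_space_wigner_noise)
  let ?S = "spiked_matrix n lam -` A \<inter> space (X n \<Otimes>\<^sub>M wigner_noise n)"
  have S: "?S \<in> sets (X n \<Otimes>\<^sub>M wigner_noise n)" by measurable
  have "emeasure (GWig n lam X) A = emeasure (X n \<Otimes>\<^sub>M wigner_noise n) ?S"
    unfolding GWig_def by (rule emeasure_distr) measurable
  also have "\<dots> = (\<integral>\<^sup>+x. emeasure (wigner_noise n) (Pair x -` ?S) \<partial>X n)"
    by (rule W.emeasure_pair_measure_alt[OF S])
  also have "\<dots> = (\<integral>\<^sup>+x. (\<integral>\<^sup>+Y. spike_ratio n lam x Y * indicator A Y \<partial>GWig0 n) \<partial>X n)"
  proof (rule nn_integral_cong)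
    fix x assume x: "x \<in> space (X n)"
    hence x': "x \<in> space (vec_space n)" using sets_eq_imp_space_eq[OF sX] by simp
    have "(\<lambda>W. spiked_matrix n lam (x, W)) \<in> measurable (wigner_noise n) (mat_space n)"
      using measurable_compose[OF measurable_Pair1'[OF x'] measurable_spiked_matrix]
      by (simp only: measurable_cong_sets[OF sets_wigner_noise refl])
    hence "emeasure (distr (wigner_noise n) (mat_space n) (\<lambda>W. spiked_matrix n lam (x, W))) A
        = emeasure (wigner_noise n) ((\<lambda>W. spiked_matrix n lam (x, W)) -` A \<inter> space (wigner_noise n))"
      by (rule emeasure_distr) fact
    also have "(\<lambda>W. spiked_matrix n lam (x, W)) -` A \<inter> space (wigner_noise n) = Pair x -` ?S"
      using x by (auto simp: space_pair_measure)
    finally show "emeasure (wigner_noise n) (Pair x -` ?S)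
        = (\<integral>\<^sup>+Y. spike_ratio n lam x Y * indicator A Y \<partial>GWig0 n)"
      unfolding distr_spiked_matrix by (subst (asm) emeasure_density) auto
  qed
  finally show ?thesis .
qed

text \<open>The likelihood ratio of a mixture is the mixture of the likelihood ratios, by
  Tonelli.\<close>

lemma GWig_eq_density:
  assumes "finite_measure (X n)" and sX: "sets (X n) = sets (vec_space n)"
  shows "GWig n lam X = density (GWig0 n) (\<lambda>Y. \<integral>\<^sup>+x. spike_ratio n lam x Y \<partial>X n)"
proof (rule measure_eqI)
  fix A assume "A \<in> sets (GWig n lam X)"
  hence A [measurable]: "A \<in> sets (mat_space n)" by simp
  note [measurable_cong] = sX
  interpret X: finite_measure "X n" by fact
  interpret P: prob_space "GWig0 n" by (rule prob_space_GWig0)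
  interpret XP: pair_sigma_finite "X n" "GWig0 n" ..
  have "emeasure (GWig n lam X) A
      = (\<integral>\<^sup>+x. (\<integral>\<^sup>+Y. spike_ratio n lam x Y * indicator A Y \<partial>GWig0 n) \<partial>X n)"
    using sX A by (rule emeasure_GWig)
  also have "\<dots> = (\<integral>\<^sup>+Y. (\<integral>\<^sup>+x. spike_ratio n lam x Y * indicator A Y \<partial>X n) \<partial>GWig0 n)"
    by (rule XP.Fubini'[symmetric]) measurable
  also have "\<dots> = (\<integral>\<^sup>+Y. (\<integral>\<^sup>+x. spike_ratio n lam x Y \<partial>X n) * indicator A Y \<partial>GWig0 n)"
  proof (rule nn_integral_cong)
    fix Y assume "Y \<in> space (GWig0 n)"
    hence Y: "Y \<in> space (mat_space n)" using sets_eq_imp_space_eq[OF sets_GWig0] by simp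
    show "(\<integral>\<^sup>+x. spike_ratio n lam x Y * indicator A Y \<partial>X n)
        = (\<integral>\<^sup>+x. spike_ratio n lam x Y \<partial>X n) * indicator A Y"
      using Y by (intro nn_integral_multc) measurable
  qed
  also have "\<dots> = emeasure (density (GWig0 n) (\<lambda>Y. \<integral>\<^sup>+x. spike_ratio n lam x Y \<partial>X n)) A"
    by (rule emeasure_density[symmetric]) measurable
  finally show "emeasure (GWig n lam X) A
      = emeasure (density (GWig0 n) (\<lambda>Y. \<integral>\<^sup>+x. spike_ratio n lam x Y \<partial>X n)) A" .
qed simp

text \<open>The product of the two shifts at \<open>(i, j)\<close> regroups as
  \<open>(x i * y i) * (x j * y j)\<close>, so the triangular sum collapses to the squared inner
  product.\<close>

lemma nn_integral_spike_ratio_mult: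
  "(\<integral>\<^sup>+Y. spike_ratio n lam x Y * spike_ratio n lam y Y \<partial>GWig0 n)
    = ennreal (exp (real n * lam\<^sup>2 / 2 * (\<Sum>i<n. x i * y i)\<^sup>2))"
proof -
  have "(\<integral>\<^sup>+Y. spike_ratio n lam x Y * spike_ratio n lam y Y \<partial>GWig0 n)
      = (\<integral>\<^sup>+g. spike_ratio n lam x (noise_matrix n g) * spike_ratio n lam y (noise_matrix n g) \<partial>upper_entries n)"
    unfolding GWig0_eq_distr by (rule nn_integral_distr) measurable
  also have "\<dots> = ennreal (exp (\<Sum>ij\<in>upper_idx n. spike_shift n lam x ij * spike_shift n lam y ij / (entry_sd ij)\<^sup>2))"
    unfolding spike_ratio_noise_matrix upper_entries_def
    by (rule nn_integral_PiM_gaussian_ratio_mult) auto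
  also have "(\<Sum>ij\<in>upper_idx n. spike_shift n lam x ij * spike_shift n lam y ij / (entry_sd ij)\<^sup>2)
      = real n * lam\<^sup>2 * (\<Sum>ij\<in>upper_idx n. (x (fst ij) * y (fst ij)) * (x (snd ij) * y (snd ij)) / (entry_sd ij)\<^sup>2)"
    unfolding sum_distrib_left
    by (rule sum.cong) (auto simp: spike_shift_def power2_eq_square algebra_simps real_sqrt_mult_self)
  also have "\<dots> = real n * lam\<^sup>2 / 2 * (\<Sum>i<n. x i * y i)\<^sup>2"
    by (subst sum_upper_idx_eq_square[of "\<lambda>i. x i * y i"]) simp
  finally show ?thesis .
qed

lemma absolutely_continuous_GWig:
  assumes "finite_measure (X n)" and sX: "sets (X n) = sets (vec_space n)"
  shows "absolutely_continuous (GWig0 n) (GWig n lam X)"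
proof -
  interpret X: finite_measure "X n" by fact
  note [measurable_cong] = sX
  show ?thesis
    unfolding GWig_eq_density[of X n lam, OF assms] by (rule absolutely_continuousI_density) measurable
qed

text \<open>Replica computation: the square of an average over the spike is an average over two
  independent copies, and Tonelli lets the noise be integrated first. \<open>RN_deriv\<close> is
  determined only almost everywhere, which the integral does not see.\<close>

lemma nn_integral_RN_deriv_GWig_square:
  assumes "finite_measure (X n)" and sX: "sets (X n) = sets (vec_space n)"
  shows "(\<integral>\<^sup>+Y. (RN_deriv (GWig0 n) (GWig n lam X) Y)\<^sup>2 \<partial>GWig0 n)
    = (\<integral>\<^sup>+x. \<integral>\<^sup>+y. ennreal (exp (real n * lam\<^sup>2 / 2 * (\<Sum>i<n. x i * y i)\<^sup>2)) \<partial>X n \<partial>X n)"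
proof -
  note [measurable_cong] = sX
  interpret X: finite_measure "X n" by fact
  interpret P: prob_space "GWig0 n" by (rule prob_space_GWig0)
  interpret XP: pair_sigma_finite "X n" "GWig0 n" ..
  let ?L = "\<lambda>Y. \<integral>\<^sup>+x. spike_ratio n lam x Y \<partial>X n"
  have meas: "?L \<in> borel_measurable (GWig0 n)" by measurable
  have mat: "Y \<in> space (GWig0 n) \<Longrightarrow> Y \<in> space (mat_space n)" for Y
    using sets_eq_imp_space_eq[OF sets_GWig0] by simp
  have "AE Y in GWig0 n. ?L Y = RN_deriv (GWig0 n) (GWig n lam X) Y"
    by (rule P.RN_deriv_unique[OF meas GWig_eq_density[of X n lam, OF assms, symmetric]])
  hence "(\<integral>\<^sup>+Y. (RN_deriv (GWig0 n) (GWig n lam X) Y)\<^sup>2 \<partial>GWig0 n) = (\<integral>\<^sup>+Y. ?L Y * ?L Y \<partial>GWig0 n)"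
    by (intro nn_integral_cong_AE) (auto simp: power2_eq_square)
  also have "\<dots> = (\<integral>\<^sup>+Y. \<integral>\<^sup>+x. spike_ratio n lam x Y * ?L Y \<partial>X n \<partial>GWig0 n)"
    using mat by (intro nn_integral_cong nn_integral_multc[symmetric]) measurable
  also have "\<dots> = (\<integral>\<^sup>+x. \<integral>\<^sup>+Y. spike_ratio n lam x Y * ?L Y \<partial>GWig0 n \<partial>X n)"
    by (rule XP.Fubini') measurable
  also have "\<dots> = (\<integral>\<^sup>+x. \<integral>\<^sup>+Y. \<integral>\<^sup>+y. spike_ratio n lam x Y * spike_ratio n lam y Y \<partial>X n \<partial>GWig0 n \<partial>X n)"
    using mat by (intro nn_integral_cong nn_integral_cmult[symmetric]) measurable
  also have "\<dots> = (\<integral>\<^sup>+x. \<integral>\<^sup>+y. \<integral>\<^sup>+Y. spike_ratio n lam x Y * spike_ratio n lam y Y \<partial>GWig0 n \<partial>X n \<partial>X n)"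
    by (intro nn_integral_cong XP.Fubini') measurable
  finally show ?thesis unfolding nn_integral_spike_ratio_mult .
qed

subsection \<open>Truncated priors and subgaussian bounds\<close>

lemma sets_truncated_prior: "sets (truncated_prior r X n) = sets (X n)"
  by (simp add: truncated_prior_def)

lemma measurable_L2_set [measurable]:
  "(\<lambda>x. L2_set x {..<n}) \<in> borel_measurable (vec_space n)"
  unfolding L2_set_def by measurable

lemma L2_set_le_iff_sum_squares_le:
  "r > 0 \<Longrightarrow> L2_set x I \<le> r \<longleftrightarrow> (\<Sum>i\<in>I. (x i)\<^sup>2) \<le> r\<^sup>2"
  unfolding L2_set_def by (metis less_eq_real_def real_le_lsqrt real_sqrt_le_iff real_sqrt_unique sum_nonneg zero_le_power2 not_le)

text \<open>Conditioning on an event of probability zero yields no probability measure, so the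
  density lemmas are phrased for finite measures and this is what they are fed.\<close>

lemma finite_measure_truncated_prior:
  assumes "prob_space (X n)" and "{x \<in> space (X n). L2_set x {..<n} \<le> r} \<in> sets (X n)"
  shows "finite_measure (truncated_prior r X n)"
proof
  interpret prob_space "X n" by fact
  show "emeasure (truncated_prior r X n) (space (truncated_prior r X n)) \<noteq> \<infinity>"
    using assms(2)
    by (auto simp: truncated_prior_def emeasure_eq_measure ennreal_divide_eq_top_iff)
qed

text \<open>The square in the exponent is linearised by averaging over a Gaussian, \<open>exp (a\<^sup>2 / 2) = E exp (a g)\<close>,
  which decouples the coordinates and lets the subgaussian bound be applied to each.\<close>

lemma subgaussian_inner_product_exp_square:
  assumes "real_distribution \<pi>" and sg: "subgaussian \<pi> (\<lambda>t. t) (\<sigma>\<^sup>2)"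
    and "0 < n" and r: "(\<Sum>i<n. (y i)\<^sup>2) \<le> r\<^sup>2" and c: "(c * \<sigma> * r)\<^sup>2 < 1"
  shows "(\<integral>\<^sup>+x. ennreal (exp (real n * c\<^sup>2 / 2 * (\<Sum>i<n. x i * y i)\<^sup>2)) \<partial>iid_prior \<pi> n)
    \<le> ennreal (1 / sqrt (1 - (c * \<sigma> * r)\<^sup>2))"
proof -
  let ?G = "density lborel std_normal_density"
  let ?X = "iid_prior \<pi> n"
  let ?D = "distr \<pi> borel (\<lambda>t. t / sqrt (real n))"
  interpret \<pi>: real_distribution \<pi> by fact
  interpret X: prob_space ?X by (rule prob_space_iid_prior) fact
  interpret G: prob_space ?G by (rule prob_space_normal_density) simp
  interpret XG: pair_sigma_finite ?X ?G ..
  interpret D: prob_space ?D by (rule \<pi>.prob_space_distr) simp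
  interpret D: product_sigma_finite "\<lambda>_::nat. ?D" ..
  note [measurable_cong] = sets_iid_prior
  let ?S = "\<lambda>x. \<Sum>i<n. x i * y i"
  \<comment> \<open>With the Gaussian variable \<open>g\<close> fixed, the exponent is linear in
    \<open>x\<close> and factors over coordinates. The variance proxies add up to a multiple of the
    sum of \<open>(y i)\<^sup>2\<close>, which is where the norm bound on \<open>y\<close> enters.
    The factor \<open>sqrt n\<close> cancels the scaling of the prior.\<close>
  have one: "(\<integral>\<^sup>+x. ennreal (exp (c * sqrt n * ?S x * g)) \<partial>?X) \<le> ennreal (exp ((c * \<sigma> * r)\<^sup>2 * g\<^sup>2 / 2))" for g
  proof -
    have "(\<integral>\<^sup>+x. ennreal (exp (c * sqrt n * ?S x * g)) \<partial>?X)
        = (\<integral>\<^sup>+x. (\<Prod>i<n. ennreal (exp (c * sqrt n * g * y i * x i))) \<partial>?X)"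
      by (intro nn_integral_cong) (simp add: prod_ennreal exp_sum[symmetric] sum_distrib_left sum_distrib_right mult_ac)
    also have "\<dots> = (\<Prod>i<n. \<integral>\<^sup>+t. ennreal (exp (c * sqrt n * g * y i * t)) \<partial>?D)"
      unfolding iid_prior_def by (rule D.product_nn_integral_prod) auto
    also have "\<dots> = (\<Prod>i<n. \<integral>\<^sup>+t. ennreal (exp (c * g * y i * t)) \<partial>\<pi>)"
      using \<open>0 < n\<close> by (simp add: nn_integral_distr mult.assoc)
    also have "\<dots> \<le> (\<Prod>i<n. ennreal (exp (\<sigma>\<^sup>2 * (c * g * y i)\<^sup>2 / 2)))"
    proof (rule prod_mono_ennreal)
      fix i
      have "integrable \<pi> (\<lambda>t. exp (c * g * y i * t))"
        "integral\<^sup>L \<pi> (\<lambda>t. exp (c * g * y i * t)) \<le> exp (\<sigma>\<^sup>2 * (c * g * y i)\<^sup>2 / 2)"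
        using sg unfolding subgaussian_def by blast+
      thus "(\<integral>\<^sup>+t. ennreal (exp (c * g * y i * t)) \<partial>\<pi>) \<le> ennreal (exp (\<sigma>\<^sup>2 * (c * g * y i)\<^sup>2 / 2))"
        by (subst nn_integral_eq_integral) (auto intro: ennreal_leI)
    qed
    also have "\<dots> = ennreal (exp (\<Sum>i<n. \<sigma>\<^sup>2 * (c * g * y i)\<^sup>2 / 2))"
      by (simp add: prod_ennreal exp_sum)
    also have "(\<Sum>i<n. \<sigma>\<^sup>2 * (c * g * y i)\<^sup>2 / 2) = \<sigma>\<^sup>2 * (c * g)\<^sup>2 / 2 * (\<Sum>i<n. (y i)\<^sup>2)"
      unfolding sum_distrib_left by (rule sum.cong) (auto simp: power_mult_distrib)
    also have "ennreal (exp \<dots>) \<le> ennreal (exp (\<sigma>\<^sup>2 * (c * g)\<^sup>2 / 2 * r\<^sup>2))"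
      using r by (intro ennreal_leI) (simp add: mult_left_mono)
    also have "\<sigma>\<^sup>2 * (c * g)\<^sup>2 / 2 * r\<^sup>2 = (c * \<sigma> * r)\<^sup>2 * g\<^sup>2 / 2"
      by (simp add: power_mult_distrib)
    finally show ?thesis .
  qed
  have "(\<integral>\<^sup>+x. ennreal (exp (real n * c\<^sup>2 / 2 * (?S x)\<^sup>2)) \<partial>?X)
      = (\<integral>\<^sup>+x. \<integral>\<^sup>+g. ennreal (exp (c * sqrt n * ?S x * g)) \<partial>?G \<partial>?X)"
    by (intro nn_integral_cong, subst nn_integral_gaussian_exp) (simp_all add: power_mult_distrib mult_ac)
  also have "\<dots> = (\<integral>\<^sup>+g. \<integral>\<^sup>+x. ennreal (exp (c * sqrt n * ?S x * g)) \<partial>?X \<partial>?G)"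
    by (rule XG.Fubini'[symmetric]) measurable
  also have "\<dots> \<le> (\<integral>\<^sup>+g. ennreal (exp ((c * \<sigma> * r)\<^sup>2 * g\<^sup>2 / 2)) \<partial>?G)"
    by (intro nn_integral_mono one)
  also have "\<dots> = ennreal (1 / sqrt (1 - (c * \<sigma> * r)\<^sup>2))"
    by (rule nn_integral_std_gaussian_exp_square) fact
  finally show ?thesis .
qed

text \<open>The terms of the cosh series are even powers, hence nonnegative, so stopping after the
  quadratic one gives a lower bound.\<close>

lemma cosh_lower_quadratic:
  fixes x :: real
  shows "1 + x\<^sup>2 / 2 \<le> cosh x"
proof -
  let ?f = "\<lambda>n. if even n then x ^ n /\<^sub>R fact n else 0"
  have "(\<Sum>n<3. ?f n) \<le> suminf ?f"
    using cosh_converges[of x] by (intro sum_le_suminf) (auto simp: sums_iff zero_le_even_power)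
  hence "(\<Sum>n<3. ?f n) \<le> cosh x"
    using cosh_converges[of x] by (simp add: sums_iff)
  thus ?thesis by (simp add: numeral_3_eq_3 power2_eq_square field_simps)
qed

text \<open>Adding the moment bounds at \<open>v\<close> and \<open>- v\<close> produces the mean of
  2 cosh (v t), which unit variance bounds below by 2 + v^2. Comparing second-order behaviour at v =
  0 forces \<open>1 \<le> s\<close>.\<close>

lemma subgaussian_unit_variance_ge_1:
  assumes "real_distribution \<pi>" and sg: "subgaussian \<pi> (\<lambda>t. t) s"
    and int2: "integrable \<pi> (\<lambda>t. t\<^sup>2)" and var: "(\<integral>t. t\<^sup>2 \<partial>\<pi>) = 1"
  shows "1 \<le> s"
proof -
  interpret real_distribution \<pi> by fact
  have ineq: "1 + v\<^sup>2 / 2 \<le> exp (s * v\<^sup>2 / 2)" for v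
  proof -
    have i: "integrable \<pi> (\<lambda>t. exp (v * t))" "integrable \<pi> (\<lambda>t. exp (- v * t))"
      "(\<integral>t. exp (v * t) \<partial>\<pi>) \<le> exp (s * v\<^sup>2 / 2)" "(\<integral>t. exp (- v * t) \<partial>\<pi>) \<le> exp (s * v\<^sup>2 / 2)"
      using sg unfolding subgaussian_def by (metis power2_minus)+
    have "2 + v\<^sup>2 = (\<integral>t. 2 + v\<^sup>2 * t\<^sup>2 \<partial>\<pi>)"
      using int2 var prob_space by simp
    also have "\<dots> \<le> (\<integral>t. exp (v * t) + exp (- v * t) \<partial>\<pi>)"
    proof (rule integral_mono)
      fix t :: real
      have "1 + (v * t)\<^sup>2 / 2 \<le> cosh (v * t)" by (rule cosh_lower_quadratic)
      thus "2 + v\<^sup>2 * t\<^sup>2 \<le> exp (v * t) + exp (- v * t)"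
        by (simp add: cosh_field_def power_mult_distrib field_simps)
    qed (use i int2 in auto)
    also have "\<dots> \<le> 2 * exp (s * v\<^sup>2 / 2)"
      using i by simp
    finally show ?thesis by simp
  qed
  show ?thesis
  proof (rule ccontr)
    assume "\<not> 1 \<le> s"
    \<comment> \<open>Substituting u = v^2 / 2 turns the second-order comparison into one of slopes
      at 0.\<close>
    have exp_ineq: "1 + u \<le> exp (s * u)" if "0 \<le> u" for u
      using ineq[of "sqrt (2 * u)"] that by simp
    have "((\<lambda>u. exp (s * u) - (1 + u)) has_real_derivative (s - 1)) (at 0)"
      by (auto intro!: derivative_eq_intros)
    from DERIV_neg_dec_right[OF this] obtain d where "d > 0"
      "\<forall>h>0. h < d \<longrightarrow> exp (s * 0) - (1 + 0) > exp (s * (0 + h)) - (1 + (0 + h))"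
      using \<open>\<not> 1 \<le> s\<close> by auto
    with exp_ineq[of "d / 2"] show False by (auto dest!: spec[of _ "d / 2"])
  qed
qed

text \<open>Applying u \<le> exp u to u = \<bar>t\<bar> / 4 and raising to the fourth power gives
  the constant 256 = 4^4. The fourth moment is what makes the variance of
  \<open>t\<^sup>2 - 1\<close> finite.\<close>

lemma subgaussian_integrable_power4:
  assumes "real_distribution \<pi>" and sg: "subgaussian \<pi> (\<lambda>t. t) s"
  shows "integrable \<pi> (\<lambda>t. t ^ 4)"
proof (rule Bochner_Integration.integrable_bound)
  interpret real_distribution \<pi> by fact
  have "integrable \<pi> (\<lambda>t. exp (1 * t))" "integrable \<pi> (\<lambda>t. exp (- 1 * t))"
    using sg unfolding subgaussian_def by blast+
  thus "integrable \<pi> (\<lambda>t. 256 * (exp t + exp (- t)))" by auto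
  show "(\<lambda>t. t ^ 4) \<in> borel_measurable \<pi>" by simp
  have "t ^ 4 \<le> 256 * (exp t + exp (- t))" for t :: real
  proof -
    have "t ^ 4 = 256 * (\<bar>t\<bar> / 4) ^ 4"
      by (simp add: power_divide)
    also have "(\<bar>t\<bar> / 4) ^ 4 \<le> exp (\<bar>t\<bar> / 4) ^ 4"
      using exp_ge_add_one_self[of "\<bar>t\<bar> / 4"] by (intro power_mono) linarith+
    also have "\<dots> = exp \<bar>t\<bar>"
      by (simp add: exp_of_nat_mult[symmetric])
    also have "exp \<bar>t\<bar> \<le> exp t + exp (- t)"
      by (cases "t \<ge> 0") auto
    finally show ?thesis by simp
  qed
  thus "AE t in \<pi>. norm (t ^ 4) \<le> norm (256 * (exp t + exp (- t)))"
    by (intro AE_I2) (simp add: abs_of_nonneg)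
qed

subsection \<open>Limit theorems for independent samples\<close>

text \<open>The Boolean index separates two independent copies of the spike.\<close>

definition sample_space :: "real measure \<Rightarrow> (nat \<times> bool \<Rightarrow> real) measure" where
  "sample_space \<pi> = (\<Pi>\<^sub>M _\<in>UNIV. \<pi>)"

text \<open>Every dimension reads from the same infinite family, because the central limit theorem
  wants one sequence of variables on one probability space.\<close>

definition sample_vec :: "nat \<Rightarrow> bool \<Rightarrow> (nat \<times> bool \<Rightarrow> real) \<Rightarrow> nat \<Rightarrow> real" where
  "sample_vec n b \<omega> = (\<lambda>i\<in>{..<n}. \<omega> (i, b) / sqrt (real n))"

context real_distribution
begin

lemma prob_space_sample_space: "prob_space (sample_space M)"
  unfolding sample_space_def by (intro prob_space_PiM prob_space_axioms)

lemma sets_sample_space [measurable_cong]: "sets (sample_space M) = sets (\<Pi>\<^sub>M _\<in>UNIV. borel)"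
  unfolding sample_space_def by (rule sets_PiM_cong) auto

lemma distr_sample: "distr (sample_space M) borel (\<lambda>\<omega>. \<omega> k) = M"
proof -
  have "distr (sample_space M) M (\<lambda>\<omega>. \<omega> k) = M"
    unfolding sample_space_def by (rule distr_PiM_component) (auto intro: prob_space_axioms)
  moreover have "distr (sample_space M) M (\<lambda>\<omega>. \<omega> k) = distr (sample_space M) borel (\<lambda>\<omega>. \<omega> k)"
    by (rule distr_cong) auto
  ultimately show ?thesis by simp
qed

text \<open>The joint law of all coordinates is \<open>sample_space M\<close> itself, which is the
  product of their marginals.\<close>

lemma indep_samples: "prob_space.indep_vars (sample_space M) (\<lambda>_. borel) (\<lambda>k \<omega>. \<omega> k) UNIV"
proof -
  interpret S: prob_space "sample_space M" by (rule prob_space_sample_space)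
  have "distr (sample_space M) (\<Pi>\<^sub>M _\<in>UNIV. borel) (\<lambda>\<omega>. \<lambda>k\<in>UNIV. \<omega> k) = sample_space M"
    by (subst (2) distr_id[symmetric], rule distr_cong) (auto simp: sets_sample_space)
  also have "\<dots> = (\<Pi>\<^sub>M k\<in>UNIV. distr (sample_space M) borel (\<lambda>\<omega>. \<omega> k))"
    unfolding distr_sample by (simp add: sample_space_def)
  finally show ?thesis
    by (subst S.indep_vars_iff_distr_eq_PiM) auto
qed

lemma indep_sample_blocks:
  assumes "disjoint_family_on K L"
    and "\<And>j. j \<in> L \<Longrightarrow> Y j \<in> measurable (\<Pi>\<^sub>M _\<in>K j. borel) (N j)"
  shows "prob_space.indep_vars (sample_space M) N (\<lambda>j \<omega>. Y j (restrict \<omega> (K j))) L"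
proof -
  interpret S: prob_space "sample_space M" by (rule prob_space_sample_space)
  show ?thesis
    using S.indep_vars_compose2[OF S.indep_vars_restrict[OF indep_samples _ assms(1)] assms(2)] by simp
qed

lemma integral_sample:
  fixes f :: "real \<Rightarrow> real"
  assumes [measurable]: "f \<in> borel_measurable borel"
  shows "integral\<^sup>L (sample_space M) (\<lambda>\<omega>. f (\<omega> k)) = integral\<^sup>L M f"
    and "integrable (sample_space M) (\<lambda>\<omega>. f (\<omega> k)) \<longleftrightarrow> integrable M f"
  using integral_distr[of "\<lambda>\<omega>. \<omega> k" "sample_space M" borel f]
    integrable_distr_eq[of "\<lambda>\<omega>. \<omega> k" "sample_space M" borel f]
  by (simp_all add: distr_sample)

lemma measurable_sample_vec [measurable]: "sample_vec n b \<in> measurable (sample_space M) (vec_space n)"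
  unfolding sample_vec_def[abs_def] by measurable

lemma distr_sample_vec:
  assumes "0 < n"
  shows "distr (sample_space M) (vec_space n) (sample_vec n b) = iid_prior M n"
proof -
  interpret S: prob_space "sample_space M" by (rule prob_space_sample_space)
  have "S.indep_vars (\<lambda>_. borel) (\<lambda>i \<omega>. (\<lambda>g. g (i, b) / sqrt (real n)) (restrict \<omega> {(i, b)})) {..<n}"
    by (rule indep_sample_blocks) (auto simp: disjoint_family_on_def)
  hence "S.indep_vars (\<lambda>_. borel) (\<lambda>i \<omega>. \<omega> (i, b) / sqrt (real n)) {..<n}" by simp
  hence "distr (sample_space M) (vec_space n) (sample_vec n b)
      = (\<Pi>\<^sub>M i\<in>{..<n}. distr (sample_space M) borel (\<lambda>\<omega>. \<omega> (i, b) / sqrt (real n)))"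
    unfolding sample_vec_def[abs_def]
    using assms by (subst (asm) S.indep_vars_iff_distr_eq_PiM) auto
  moreover have "distr (sample_space M) borel (\<lambda>\<omega>. \<omega> (i, b) / sqrt (real n))
      = distr M borel (\<lambda>t. t / sqrt (real n))" for i
    by (subst distr_sample[of "(i, b)", symmetric], subst distr_distr) (auto simp: comp_def)
  ultimately show ?thesis by (simp add: iid_prior_def)
qed

text \<open>The two copies read disjoint sets of coordinates and are therefore independent;
  integrals over a pair of spikes become expectations on the sample space.\<close>

lemma distr_sample_vec_pair:
  assumes "0 < n"
  shows "distr (sample_space M) (vec_space n \<Otimes>\<^sub>M vec_space n) (\<lambda>\<omega>. (sample_vec n True \<omega>, sample_vec n False \<omega>))
    = iid_prior M n \<Otimes>\<^sub>M iid_prior M n"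
proof -
  interpret S: prob_space "sample_space M" by (rule prob_space_sample_space)
  let ?K = "\<lambda>b. {..<n} \<times> {b :: bool}"
  let ?Y = "\<lambda>b g. \<lambda>i\<in>{..<n}. g (i, b) / sqrt (real n) :: real"
  have Y: "?Y b \<in> measurable (\<Pi>\<^sub>M _\<in>?K b. borel) (vec_space n)" for b
    by (rule measurable_restrict, rule borel_measurable_divide, rule measurable_component_singleton) auto
  have "S.indep_var (vec_space n) (?Y True \<circ> (\<lambda>\<omega>. restrict \<omega> (?K True)))
      (vec_space n) (?Y False \<circ> (\<lambda>\<omega>. restrict \<omega> (?K False)))"
    by (rule S.indep_var_compose[OF S.indep_var_restrict[OF indep_samples] Y Y]) auto
  moreover have "?Y b \<circ> (\<lambda>\<omega>. restrict \<omega> (?K b)) = sample_vec n b" for b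
    by (auto simp: sample_vec_def fun_eq_iff)
  ultimately have "S.indep_var (vec_space n) (sample_vec n True) (vec_space n) (sample_vec n False)"
    by simp
  thus ?thesis
    using assms by (simp add: S.indep_var_distribution_eq distr_sample_vec)
qed

text \<open>Up to the factor \<open>1 / sqrt n\<close>, the rescaled inner product is a sum of the
  i.i.d. variables \<open>Z i\<close>, each a product of two independent samples. Independence gives
  mean 0 and second moment 1 * 1. Weak convergence is then tested on a bounded continuous
  \<open>f\<close>.\<close>

lemma clt_inner_product:
  assumes mean: "integrable M (\<lambda>t. t)" "expectation (\<lambda>t. t) = 0"
    and var: "integrable M (\<lambda>t. t\<^sup>2)" "expectation (\<lambda>t. t\<^sup>2) = 1"
    and f: "\<And>z. isCont f z" "\<And>z::real. norm (f z :: real) \<le> B"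
  shows "(\<lambda>n. \<integral>p. f (sqrt n * (\<Sum>i<n. fst p i * snd p i)) \<partial>(iid_prior M n \<Otimes>\<^sub>M iid_prior M n))
    \<longlonglongrightarrow> integral\<^sup>L std_normal_distribution f"
proof -
  interpret S: prob_space "sample_space M" by (rule prob_space_sample_space)
  define Z where "Z i \<omega> = \<omega> (i, True) * \<omega> (i, False)" for i :: nat and \<omega> :: "nat \<times> bool \<Rightarrow> real"
  have [measurable]: "Z i \<in> borel_measurable (sample_space M)" for i
    unfolding Z_def[abs_def] by measurable
  have fm [measurable]: "f \<in> borel_measurable borel"
    using f(1) by (intro borel_measurable_continuous_onI continuous_at_imp_continuous_on) auto
  have ind2: "S.indep_var borel (\<lambda>\<omega>. \<omega> (i, True)) borel (\<lambda>\<omega>. \<omega> (i, False))" for i :: nat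
    using S.indep_var_compose[OF S.indep_var_restrict[OF indep_samples, of "{(i, True)}" "{(i, False)}"],
        of "\<lambda>g. g (i, True)" borel "\<lambda>g. g (i, False)" borel]
    by (simp add: comp_def)
  have "S.indep_vars (\<lambda>_. borel) (\<lambda>i \<omega>. (\<lambda>g. g (i, True) * g (i, False)) (restrict \<omega> ({i} \<times> UNIV))) UNIV"
    by (rule indep_sample_blocks) (auto simp: disjoint_family_on_def)
  hence ind: "S.indep_vars (\<lambda>_. borel) Z UNIV"
    by (simp add: Z_def[abs_def])
  have id_borel: "(\<lambda>t::real. t) \<in> borel_measurable borel" by simp
  have int1: "integrable (sample_space M) (\<lambda>\<omega>. \<omega> k)" "S.expectation (\<lambda>\<omega>. \<omega> k) = 0" for k
    by (rule iffD2[OF integral_sample(2)[OF id_borel] mean(1)],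
        rule trans[OF integral_sample(1)[OF id_borel] mean(2)])
  have ex: "S.expectation (Z i) = 0" for i
    unfolding Z_def[abs_def] S.indep_var_lebesgue_integral[OF ind2[of i] int1(1) int1(1)] int1(2) by simp
  have int2: "integrable (sample_space M) (\<lambda>\<omega>. (\<omega> k)\<^sup>2)" "S.expectation (\<lambda>\<omega>. (\<omega> k)\<^sup>2) = 1" for k
    using integral_sample[of "\<lambda>t. t\<^sup>2" k] var by auto
  have ind_sq: "S.indep_var borel (\<lambda>\<omega>. (\<omega> (i, True))\<^sup>2) borel (\<lambda>\<omega>. (\<omega> (i, False))\<^sup>2)" for i :: nat
    using S.indep_var_compose[OF ind2[of i], of "\<lambda>t. t\<^sup>2" borel "\<lambda>t. t\<^sup>2" borel] by (simp add: comp_def)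
  have sq: "integrable (sample_space M) (\<lambda>\<omega>. (Z i \<omega>)\<^sup>2)" "S.expectation (\<lambda>\<omega>. (Z i \<omega>)\<^sup>2) = 1" for i
    unfolding Z_def power_mult_distrib S.indep_var_lebesgue_integral[OF ind_sq[of i] int2(1) int2(1)] int2(2)
    using S.indep_var_integrable[OF ind_sq[of i] int2(1) int2(1)] by simp_all
  \<comment> \<open>Identical distribution: the law of \<open>Z i\<close> is the image of the
    product of \<open>M\<close> with itself under multiplication, whatever \<open>i\<close>
    is.\<close>
  have distr: "distr (sample_space M) borel (Z i) = distr (M \<Otimes>\<^sub>M M) borel (\<lambda>p. fst p * snd p)" for i
  proof -
    have joint: "M \<Otimes>\<^sub>M M = distr (sample_space M) (borel \<Otimes>\<^sub>M borel) (\<lambda>\<omega>. (\<omega> (i, True), \<omega> (i, False)))"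
      using ind2[of i] by (simp add: S.indep_var_distribution_eq distr_sample)
    show ?thesis
      unfolding joint by (subst distr_distr) (auto simp: comp_def Z_def[abs_def])
  qed
  have "weak_conv_m (\<lambda>n. distr (sample_space M) borel (\<lambda>\<omega>. (\<Sum>i<n. Z i \<omega>) / sqrt (real n * 1\<^sup>2))) std_normal_distribution"
    by (rule S.central_limit_theorem_zero_mean[OF ind ex _ sq(1) _ distr]) (simp_all add: ex sq)
  hence "(\<lambda>n. integral\<^sup>L (distr (sample_space M) borel (\<lambda>\<omega>. (\<Sum>i<n. Z i \<omega>) / sqrt (real n * 1\<^sup>2))) f)
      \<longlonglongrightarrow> integral\<^sup>L std_normal_distribution f"
    by (intro weak_conv_imp_integral_bdd_continuous_conv[where B = B] f S.real_distribution_distr real_dist_normal_dist) measurable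
  moreover have "\<forall>\<^sub>F n in sequentially.
      integral\<^sup>L (distr (sample_space M) borel (\<lambda>\<omega>. (\<Sum>i<n. Z i \<omega>) / sqrt (real n * 1\<^sup>2))) f
      = (\<integral>p. f (sqrt n * (\<Sum>i<n. fst p i * snd p i)) \<partial>(iid_prior M n \<Otimes>\<^sub>M iid_prior M n))"
    using eventually_gt_at_top[of 0]
  proof eventually_elim
    case (elim n)
    have "sqrt n * (\<Sum>i<n. sample_vec n True \<omega> i * sample_vec n False \<omega> i) = (\<Sum>i<n. Z i \<omega>) / sqrt n" for \<omega>
      using elim unfolding sum_distrib_left sum_divide_distrib
      by (intro sum.cong) (auto simp: sample_vec_def Z_def field_simps)
    thus ?case
      unfolding distr_sample_vec_pair[OF elim, symmetric]
      by (simp add: integral_distr)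
  qed
  ultimately show ?thesis by (rule Lim_transform_eventually)
qed

text \<open>The squared norm minus 1 is the average of the centred variables \<open>V i\<close>, so
  its variance is \<tau> / n and Chebyshev's inequality applies.\<close>

lemma norm_iid_prior_concentrates:
  assumes var: "integrable M (\<lambda>t. t\<^sup>2)" "expectation (\<lambda>t. t\<^sup>2) = 1"
    and int4: "integrable M (\<lambda>t. t ^ 4)" and r: "1 < r"
  shows "(\<lambda>n. measure (iid_prior M n) {x \<in> space (iid_prior M n). L2_set x {..<n} \<le> r}) \<longlonglongrightarrow> 1"
proof -
  interpret S: prob_space "sample_space M" by (rule prob_space_sample_space)
  note [measurable_cong] = sets_iid_prior
  define V where "V i \<omega> = (\<omega> (i, True))\<^sup>2 - 1" for i :: nat and \<omega> :: "nat \<times> bool \<Rightarrow> real"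
  define \<tau> where "\<tau> = expectation (\<lambda>t. (t\<^sup>2 - 1)\<^sup>2)"
  \<comment> \<open>A deviation of the sum below \<open>c * n\<close> keeps the squared norm below 1
    + c = r^2.\<close>
  define c where "c = r\<^sup>2 - 1"
  have c: "0 < c" using r by (simp add: c_def power2_eq_square algebra_simps mult_strict_mono less_1_mult)
  have [measurable]: "V i \<in> borel_measurable (sample_space M)" for i
    unfolding V_def[abs_def] by measurable
  have intV: "integrable (sample_space M) (V i)" and exV: "S.expectation (V i) = 0" for i
    using integral_sample[of "\<lambda>t. t\<^sup>2 - 1" "(i, True)"] var prob_space by (simp_all add: V_def[abs_def])
  have eq4: "(t\<^sup>2 - 1)\<^sup>2 = t ^ 4 - 2 * t\<^sup>2 + 1" for t :: real
    by (simp add: power2_eq_square power4_eq_xxxx algebra_simps)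
  have "integrable M (\<lambda>t. (t\<^sup>2 - 1)\<^sup>2)"
    unfolding eq4 using var int4 by simp
  hence intV2: "integrable (sample_space M) (\<lambda>\<omega>. V i \<omega> * V i \<omega>)"
    and exV2: "S.expectation (\<lambda>\<omega>. V i \<omega> * V i \<omega>) = \<tau>" for i
    using integral_sample[of "\<lambda>t. (t\<^sup>2 - 1)\<^sup>2" "(i, True)"]
    by (simp_all add: V_def[abs_def] \<tau>_def power2_eq_square)
  \<comment> \<open>Pairwise independence suffices, since the variance of a sum involves only
    products of two terms.\<close>
  have ind: "S.indep_var borel (V i) borel (V j)" if "i \<noteq> j" for i j
    using S.indep_var_compose[OF S.indep_var_restrict[OF indep_samples, of "{(i, True)}" "{(j, True)}"],
        of "\<lambda>g. (g (i, True))\<^sup>2 - 1" borel "\<lambda>g. (g (j, True))\<^sup>2 - 1" borel] that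
    by (simp add: comp_def V_def[abs_def])
  have intVV: "integrable (sample_space M) (\<lambda>\<omega>. V i \<omega> * V j \<omega>)" for i j
    using S.indep_var_integrable[OF ind[of i j]] intV intV2 by (cases "i = j") auto
  have exVV: "S.expectation (\<lambda>\<omega>. V i \<omega> * V j \<omega>) = (if i = j then \<tau> else 0)" for i j
    using S.indep_var_lebesgue_integral[OF ind[of i j]] intV exV exV2 by auto
  have bound: "1 - \<tau> / c\<^sup>2 * inverse (real n)
      \<le> measure (iid_prior M n) {x \<in> space (iid_prior M n). L2_set x {..<n} \<le> r}" if n: "0 < n" for n
  proof -
    let ?S = "\<lambda>\<omega>. \<Sum>i<n. V i \<omega>"
    have sq: "(?S \<omega>)\<^sup>2 = (\<Sum>i<n. \<Sum>j<n. V i \<omega> * V j \<omega>)" for \<omega>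
      by (simp add: power2_eq_square sum_product)
    have ex0: "S.expectation ?S = 0" using intV exV by simp
    have "S.variance ?S = real n * \<tau>"
      unfolding ex0 by (simp add: sq intVV exVV)
    moreover have "S.prob {\<omega>\<in>space (sample_space M). \<bar>?S \<omega> - S.expectation ?S\<bar> \<ge> c * n}
        \<le> S.variance ?S / (c * n)\<^sup>2"
      by (rule S.Chebyshev_inequality) (use c n in \<open>auto simp: sq intVV\<close>)
    ultimately have "S.prob {\<omega>\<in>space (sample_space M). \<bar>?S \<omega>\<bar> \<ge> c * n} \<le> real n * \<tau> / (c * n)\<^sup>2"
      by (simp only: ex0 diff_0_right)
    also have "\<dots> = \<tau> / c\<^sup>2 * inverse (real n)"
      using n by (simp add: power2_eq_square field_simps)
    finally have cheb: "S.prob {\<omega>\<in>space (sample_space M). \<bar>?S \<omega>\<bar> \<ge> c * n} \<le> \<tau> / c\<^sup>2 * inverse (real n)" .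
    have L2: "L2_set (sample_vec n True \<omega>) {..<n} \<le> r" if "\<bar>?S \<omega>\<bar> < c * n" for \<omega>
    proof -
      have "?S \<omega> = (\<Sum>i<n. (\<omega> (i, True))\<^sup>2) - n" by (simp add: V_def sum_subtractf)
      hence "(\<Sum>i<n. (\<omega> (i, True))\<^sup>2) / n \<le> r\<^sup>2"
        using that n by (simp add: c_def field_simps abs_less_iff)
      thus ?thesis
        using r by (simp add: L2_set_le_iff_sum_squares_le sample_vec_def power_divide sum_divide_distrib)
    qed
    have "1 - S.prob {\<omega>\<in>space (sample_space M). \<bar>?S \<omega>\<bar> \<ge> c * n}
        = S.prob (space (sample_space M) - {\<omega>\<in>space (sample_space M). \<bar>?S \<omega>\<bar> \<ge> c * n})"
      by (rule S.prob_compl[symmetric]) measurable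
    also have "\<dots> \<le> S.prob {\<omega>\<in>space (sample_space M). L2_set (sample_vec n True \<omega>) {..<n} \<le> r}"
      by (rule S.finite_measure_mono) (auto intro: L2)
    also have "\<dots> = measure (iid_prior M n) {x \<in> space (iid_prior M n). L2_set x {..<n} \<le> r}"
      unfolding distr_sample_vec[OF n, of True, symmetric]
      by (subst measure_distr) (auto intro!: arg_cong[where f = S.prob] simp: measurable_space[OF measurable_sample_vec])
    finally show ?thesis using cheb by linarith
  qed
  have "(\<lambda>n. 1 - \<tau> / c\<^sup>2 * inverse (real n)) \<longlonglongrightarrow> 1 - \<tau> / c\<^sup>2 * 0"
    by (intro tendsto_intros LIMSEQ_inverse_real_of_nat lim_inverse_n)
  hence lim: "(\<lambda>n. 1 - \<tau> / c\<^sup>2 * inverse (real n)) \<longlonglongrightarrow> 1" by simp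
  show ?thesis
  proof (rule tendsto_sandwich[OF _ _ lim tendsto_const])
    show "\<forall>\<^sub>F n in sequentially. 1 - \<tau> / c\<^sup>2 * inverse (real n)
        \<le> measure (iid_prior M n) {x \<in> space (iid_prior M n). L2_set x {..<n} \<le> r}"
      using eventually_gt_at_top[of 0] by eventually_elim (rule bound)
    show "\<forall>\<^sub>F n in sequentially.
        measure (iid_prior M n) {x \<in> space (iid_prior M n). L2_set x {..<n} \<le> r} \<le> 1"
      using prob_space.prob_le_1[OF prob_space_iid_prior[OF real_distribution_axioms]] by simp
  qed
qed

end

subsection \<open>The second moment under truncation\<close>

text \<open>An exchange of limits: \<open>k\<close> is fixed first so that \<open>a k\<close> is
  near \<open>l\<close> (and, for the upper bound, \<open>e k\<close> near 0), and only then does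
  \<open>n\<close> grow. The error \<open>e k\<close> must be uniform in \<open>n\<close>, whereas
  \<open>R k n\<close> need only vanish for each \<open>k\<close>.\<close>

lemma tendsto_via_truncation:
  fixes J :: "nat \<Rightarrow> ennreal" and A R :: "nat \<Rightarrow> nat \<Rightarrow> ennreal"
  assumes upper: "\<And>k. \<forall>\<^sub>F n in sequentially. J n \<le> A k n + e k"
    and lower: "\<And>k. \<forall>\<^sub>F n in sequentially. A k n \<le> J n + R k n"
    and A: "\<And>k. A k \<longlonglongrightarrow> a k" and R: "\<And>k. R k \<longlonglongrightarrow> 0"
    and a: "a \<longlonglongrightarrow> l" and e: "e \<longlonglongrightarrow> 0"
    and a_finite: "\<And>k. a k \<noteq> \<infinity>" and R_finite: "\<And>k n. R k n \<noteq> \<infinity>"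
  shows "J \<longlonglongrightarrow> l"
proof (rule order_tendstoI)
  fix u assume "u > l"
  have "(\<lambda>k. a k + e k) \<longlonglongrightarrow> l + 0" by (intro tendsto_add a e)
  with \<open>u > l\<close> have "\<forall>\<^sub>F k in sequentially. a k + e k < u" by (auto dest: order_tendstoD(2))
  then obtain k where k: "a k + e k < u" by (auto simp: eventually_sequentially)
  have "(\<lambda>n. A k n + e k) \<longlonglongrightarrow> a k + e k" by (intro tendsto_add A tendsto_const)
  from order_tendstoD(2)[OF this k] upper[of k] show "\<forall>\<^sub>F n in sequentially. J n < u"
    by eventually_elim order
next
  fix u assume "u < l"
  with a have "\<forall>\<^sub>F k in sequentially. u < a k" by (auto dest: order_tendstoD(1))
  then obtain k where k: "u < a k" by (auto simp: eventually_sequentially)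
  \<comment> \<open>Subtraction in \<open>ennreal\<close> behaves only away from infinity; this is
    where \<open>a_finite\<close> enters, and \<open>R_finite\<close> is used below to move
    \<open>R k n\<close> across the inequality.\<close>
  have "(\<lambda>n. A k n - R k n) \<longlonglongrightarrow> a k - 0"
    using A R a_finite[of k] by (intro tendsto_diff_ennreal) auto
  hence "\<forall>\<^sub>F n in sequentially. u < A k n - R k n" using k by (auto dest: order_tendstoD(1))
  with lower[of k] show "\<forall>\<^sub>F n in sequentially. u < J n"
  proof eventually_elim
    case (elim n)
    have "A k n - R k n \<le> J n"
      using elim(1) R_finite[of k n] by (simp add: ennreal_minus_le_iff add.commute)
    with elim(2) show "u < J n" by (rule less_le_trans)
  qed
qed

context real_distribution
begin

text \<open>The integrand is compared with its version of capped exponent, integrated over the full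
  prior: the central limit theorem governs the capped part, and a slightly larger exponent \<mu>
  controls what the cap removes. The condition \<open>lam * \<sigma> * r < 1\<close> serves the
  tail, \<open>lam < 1\<close> the Gaussian limit.\<close>

lemma truncated_second_moment_limit:
  fixes \<sigma> lam r :: real
  assumes mean: "integrable M (\<lambda>t. t)" "expectation (\<lambda>t. t) = 0"
    and var: "integrable M (\<lambda>t. t\<^sup>2)" "expectation (\<lambda>t. t\<^sup>2) = 1"
    and sg: "subgaussian M (\<lambda>t. t) (\<sigma>\<^sup>2)" and pos: "0 < \<sigma>" "0 \<le> lam" "1 < r"
    and lam: "lam * \<sigma> * r < 1" "lam < 1"
  defines "X \<equiv> iid_prior M"
  defines "B \<equiv> \<lambda>n. {x \<in> space (X n). L2_set x {..<n} \<le> r}"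
  shows "(\<lambda>n. \<integral>\<^sup>+x. (\<integral>\<^sup>+y. ennreal (exp (real n * lam\<^sup>2 / 2 * (\<Sum>i<n. x i * y i)\<^sup>2)) * indicator (B n) y \<partial>X n)
      * indicator (B n) x \<partial>X n) \<longlonglongrightarrow> ennreal (1 / sqrt (1 - lam\<^sup>2))"
proof -
  \<comment> \<open>The midpoint between \<open>lam\<close> and the critical value
    \<open>1 / (\<sigma> * r)\<close>.\<close>
  define \<mu> where "\<mu> = (lam + 1 / (\<sigma> * r)) / 2"
  have "lam < 1 / (\<sigma> * r)" using lam pos by (simp add: field_simps)
  hence \<mu>: "lam < \<mu>" "\<mu> < 1 / (\<sigma> * r)" by (auto simp: \<mu>_def)
  have "0 < \<mu>" using \<mu> pos by linarith
  have "\<mu> * \<sigma> * r < 1" using \<mu>(2) pos by (simp add: field_simps)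
  hence \<mu>1: "(\<mu> * \<sigma> * r)\<^sup>2 < 1" using \<open>0 < \<mu>\<close> pos by (simp add: power_less_one_iff)
  have sq_lt: "lam\<^sup>2 < \<mu>\<^sup>2" using \<mu>(1) pos by (intro power_strict_mono) auto
  note [measurable_cong] = sets_iid_prior
  have psX: "prob_space (X n)" for n
    unfolding X_def by (rule prob_space_iid_prior[OF real_distribution_axioms])
  have sX [measurable_cong]: "sets (X n) = sets (vec_space n)" for n
    by (simp add: X_def sets_iid_prior)
  have Bm [measurable]: "B n \<in> sets (X n)" for n
    unfolding B_def by measurable
  define z where "z n x y = sqrt (real n) * (\<Sum>i<n. x i * y i)" for n and x y :: "nat \<Rightarrow> real"
  have zm [measurable]: "(\<lambda>p. z n (fst p) (snd p)) \<in> borel_measurable (vec_space n \<Otimes>\<^sub>M vec_space n)" for n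
    unfolding z_def by measurable
  have zm1 [measurable]: "z n x \<in> borel_measurable (vec_space n)" for n x
    unfolding z_def[abs_def] by measurable
  have z_sq: "real n * c / 2 * (\<Sum>i<n. x i * y i)\<^sup>2 = c * (z n x y)\<^sup>2 / 2" for n x y c
    by (simp add: z_def power_mult_distrib)
  \<comment> \<open>Cutting off the exponent keeps the test functions bounded, and also covers \<open>lam = 0\<close>.\<close>
  define f where "f k t = exp (lam\<^sup>2 * min (t\<^sup>2) (real k) / 2)" for k and t :: real
  define J where "J n = (\<integral>\<^sup>+x. (\<integral>\<^sup>+y. ennreal (exp (lam\<^sup>2 * (z n x y)\<^sup>2 / 2)) * indicator (B n) y \<partial>X n)
      * indicator (B n) x \<partial>X n)" for n
  define A where "A k n = (\<integral>\<^sup>+x. \<integral>\<^sup>+y. ennreal (f k (z n x y)) \<partial>X n \<partial>X n)" for k n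
  define C where "C = ennreal (1 / sqrt (1 - (\<mu> * \<sigma> * r)\<^sup>2))"
  have f_cont: "isCont (f k) t" for k t
    unfolding f_def by (intro continuous_intros) auto
  have fm [measurable]: "f k \<in> borel_measurable borel" for k
    unfolding f_def by measurable
  have f_bound: "f k t \<le> exp (lam\<^sup>2 * k / 2)" for k t
    unfolding f_def by (simp add: mult_left_mono)
  have f_pos: "0 \<le> f k t" for k t by (simp add: f_def)
  have f_le: "f k t \<le> exp (lam\<^sup>2 * t\<^sup>2 / 2)" for k t
    unfolding f_def by (simp add: mult_left_mono)
  \<comment> \<open>Where t^2 exceeds \<open>k\<close>, trading lam^2 for \<mu>^2 in the exponent
    gains a factor that decays exponentially in \<open>k\<close> and does not depend on
    \<open>n\<close>.\<close>
  have tail: "exp (lam\<^sup>2 * t\<^sup>2 / 2) \<le> f k t + exp (- (\<mu>\<^sup>2 - lam\<^sup>2) * k / 2) * exp (\<mu>\<^sup>2 * t\<^sup>2 / 2)" for k t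
  proof (cases "t\<^sup>2 \<le> real k")
    case False
    have "0 \<le> (\<mu>\<^sup>2 - lam\<^sup>2) * (t\<^sup>2 - k)" using False sq_lt by simp
    hence "lam\<^sup>2 * t\<^sup>2 / 2 \<le> - (\<mu>\<^sup>2 - lam\<^sup>2) * k / 2 + \<mu>\<^sup>2 * t\<^sup>2 / 2" by (simp add: field_simps)
    hence "exp (lam\<^sup>2 * t\<^sup>2 / 2) \<le> exp (- (\<mu>\<^sup>2 - lam\<^sup>2) * k / 2) * exp (\<mu>\<^sup>2 * t\<^sup>2 / 2)"
      unfolding exp_add[symmetric] by simp
    thus ?thesis using f_pos[of k t] by linarith
  qed (simp add: f_def)
  \<comment> \<open>The indicator for \<open>x\<close> is dropped and the one for \<open>y\<close>
    kept: after swapping the integrals, the subgaussian bound integrates \<open>x\<close> over the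
    full prior for each fixed \<open>y\<close> in \<open>B n\<close>.\<close>
  have upper: "J n \<le> A k n + ennreal (exp (- (\<mu>\<^sup>2 - lam\<^sup>2) * k / 2)) * C" if n: "0 < n" for n k
  proof -
    interpret X: prob_space "X n" by (rule psX)
    interpret XX: pair_sigma_finite "X n" "X n" ..
    let ?q = "ennreal (exp (- (\<mu>\<^sup>2 - lam\<^sup>2) * k / 2))"
    have "J n \<le> (\<integral>\<^sup>+x. \<integral>\<^sup>+y. ennreal (f k (z n x y))
        + ?q * (ennreal (exp (\<mu>\<^sup>2 * (z n x y)\<^sup>2 / 2)) * indicator (B n) y) \<partial>X n \<partial>X n)"
      unfolding J_def
    proof (intro nn_integral_mono)
      fix x
      have "(\<integral>\<^sup>+y. ennreal (exp (lam\<^sup>2 * (z n x y)\<^sup>2 / 2)) * indicator (B n) y \<partial>X n) * indicator (B n) x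
          \<le> (\<integral>\<^sup>+y. ennreal (exp (lam\<^sup>2 * (z n x y)\<^sup>2 / 2)) * indicator (B n) y \<partial>X n)"
        by (simp add: indicator_def)
      also have "\<dots> \<le> (\<integral>\<^sup>+y. ennreal (f k (z n x y))
          + ?q * (ennreal (exp (\<mu>\<^sup>2 * (z n x y)\<^sup>2 / 2)) * indicator (B n) y) \<partial>X n)"
      proof (rule nn_integral_mono)
        fix y
        have "ennreal (exp (lam\<^sup>2 * (z n x y)\<^sup>2 / 2))
            \<le> ennreal (f k (z n x y)) + ?q * ennreal (exp (\<mu>\<^sup>2 * (z n x y)\<^sup>2 / 2))"
          using tail[of "z n x y" k] f_pos
          by (simp add: ennreal_mult[symmetric] ennreal_plus[symmetric] ennreal_leI del: ennreal_plus)
        thus "ennreal (exp (lam\<^sup>2 * (z n x y)\<^sup>2 / 2)) * indicator (B n) y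
            \<le> ennreal (f k (z n x y)) + ?q * (ennreal (exp (\<mu>\<^sup>2 * (z n x y)\<^sup>2 / 2)) * indicator (B n) y)"
          by (simp add: indicator_def)
      qed
      finally show "(\<integral>\<^sup>+y. ennreal (exp (lam\<^sup>2 * (z n x y)\<^sup>2 / 2)) * indicator (B n) y \<partial>X n) * indicator (B n) x
          \<le> (\<integral>\<^sup>+y. ennreal (f k (z n x y))
          + ?q * (ennreal (exp (\<mu>\<^sup>2 * (z n x y)\<^sup>2 / 2)) * indicator (B n) y) \<partial>X n)" .
    qed
    also have "\<dots> = A k n
        + ?q * (\<integral>\<^sup>+x. \<integral>\<^sup>+y. ennreal (exp (\<mu>\<^sup>2 * (z n x y)\<^sup>2 / 2)) * indicator (B n) y \<partial>X n \<partial>X n)"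
      unfolding A_def by (simp add: nn_integral_add nn_integral_cmult)
    also have "(\<integral>\<^sup>+x. \<integral>\<^sup>+y. ennreal (exp (\<mu>\<^sup>2 * (z n x y)\<^sup>2 / 2)) * indicator (B n) y \<partial>X n \<partial>X n)
        = (\<integral>\<^sup>+y. \<integral>\<^sup>+x. ennreal (exp (\<mu>\<^sup>2 * (z n x y)\<^sup>2 / 2)) * indicator (B n) y \<partial>X n \<partial>X n)"
      by (rule XX.Fubini'[symmetric]) measurable
    also have "\<dots> \<le> (\<integral>\<^sup>+y. C \<partial>X n)"
    proof (rule nn_integral_mono)
      fix y assume "y \<in> space (X n)"
      show "(\<integral>\<^sup>+x. ennreal (exp (\<mu>\<^sup>2 * (z n x y)\<^sup>2 / 2)) * indicator (B n) y \<partial>X n) \<le> C"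
      proof (cases "y \<in> B n")
        case True
        hence "(\<Sum>i<n. (y i)\<^sup>2) \<le> r\<^sup>2" using pos by (simp add: B_def L2_set_le_iff_sum_squares_le)
        from subgaussian_inner_product_exp_square[OF real_distribution_axioms sg n this \<mu>1]
        have "(\<integral>\<^sup>+x. ennreal (exp (\<mu>\<^sup>2 * (z n x y)\<^sup>2 / 2)) \<partial>X n) \<le> C"
          unfolding z_sq C_def X_def .
        thus ?thesis using True by simp
      qed simp
    qed
    also have "\<dots> = C" by (simp add: X.emeasure_space_1)
    finally show ?thesis by (simp add: mult_left_mono)
  qed
  \<comment> \<open>The factor 2 is a union bound over \<open>x\<close> or \<open>y\<close> falling
    outside \<open>B n\<close>; on either event the capped integrand is at most
    \<open>exp (lam\<^sup>2 * k / 2)\<close>.\<close>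
  define R where "R k n = 2 * ennreal (exp (lam\<^sup>2 * k / 2)) * ennreal (1 - measure (X n) (B n))" for k n
  have lower: "A k n \<le> J n + R k n" for n k
  proof -
    interpret X: prob_space "X n" by (rule psX)
    let ?E = "ennreal (exp (lam\<^sup>2 * k / 2))"
    let ?c = "\<lambda>x. indicator (space (X n) - B n) x :: ennreal"
    have "A k n \<le> (\<integral>\<^sup>+x. \<integral>\<^sup>+y. ennreal (exp (lam\<^sup>2 * (z n x y)\<^sup>2 / 2)) * indicator (B n) y * indicator (B n) x
        + (?E * ?c x + ?E * ?c y) \<partial>X n \<partial>X n)"
      unfolding A_def
    proof (intro nn_integral_mono)
      fix x y assume xy: "x \<in> space (X n)" "y \<in> space (X n)"
      have "ennreal (f k (z n x y)) \<le> ?E" "ennreal (f k (z n x y)) \<le> ennreal (exp (lam\<^sup>2 * (z n x y)\<^sup>2 / 2))"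
        using f_bound f_le by (auto intro: ennreal_leI)
      thus "ennreal (f k (z n x y)) \<le> ennreal (exp (lam\<^sup>2 * (z n x y)\<^sup>2 / 2)) * indicator (B n) y * indicator (B n) x
          + (?E * ?c x + ?E * ?c y)"
        using xy by (cases "x \<in> B n"; cases "y \<in> B n") (auto intro: order_trans add_increasing2)
    qed
    also have "\<dots> = J n + (?E * emeasure (X n) (space (X n) - B n) + ?E * emeasure (X n) (space (X n) - B n))"
      unfolding J_def
      by (simp add: nn_integral_add nn_integral_cmult nn_integral_multc X.emeasure_space_1)
    also have "emeasure (X n) (space (X n) - B n) = ennreal (1 - measure (X n) (B n))"
      by (simp add: X.emeasure_eq_measure X.prob_compl)
    finally show ?thesis by (simp add: R_def mult_2 distrib_right)
  qed
  have A_lim: "A k \<longlonglongrightarrow> (\<integral>\<^sup>+t. ennreal (f k t) \<partial>std_normal_distribution)" for k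
  proof -
    interpret N: real_distribution std_normal_distribution by (rule real_dist_normal_dist)
    have "(\<lambda>n. \<integral>p. f k (z n (fst p) (snd p)) \<partial>(X n \<Otimes>\<^sub>M X n)) \<longlonglongrightarrow> integral\<^sup>L std_normal_distribution (f k)"
      unfolding X_def z_def
      using f_bound f_pos by (intro clt_inner_product[OF mean var f_cont]) (auto simp: abs_of_nonneg)
    hence "(\<lambda>n. ennreal (\<integral>p. f k (z n (fst p) (snd p)) \<partial>(X n \<Otimes>\<^sub>M X n)))
        \<longlonglongrightarrow> ennreal (integral\<^sup>L std_normal_distribution (f k))"
      by (rule tendsto_ennrealI)
    moreover have "ennreal (integral\<^sup>L std_normal_distribution (f k)) = (\<integral>\<^sup>+t. ennreal (f k t) \<partial>std_normal_distribution)"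
      using f_bound f_pos
      by (intro nn_integral_eq_integral[symmetric] N.integrable_const_bound[of _ "exp (lam\<^sup>2 * k / 2)"]) auto
    moreover have "ennreal (\<integral>p. f k (z n (fst p) (snd p)) \<partial>(X n \<Otimes>\<^sub>M X n)) = A k n" for n
    proof -
      interpret X: prob_space "X n" by (rule psX)
      interpret XX: pair_prob_space "X n" "X n" ..
      have m: "(\<lambda>p. f k (z n (fst p) (snd p))) \<in> borel_measurable (X n \<Otimes>\<^sub>M X n)" by measurable
      have "ennreal (\<integral>p. f k (z n (fst p) (snd p)) \<partial>(X n \<Otimes>\<^sub>M X n))
          = (\<integral>\<^sup>+p. ennreal (f k (z n (fst p) (snd p))) \<partial>(X n \<Otimes>\<^sub>M X n))"
        using f_bound f_pos m
        by (intro nn_integral_eq_integral[symmetric] XX.integrable_const_bound[of _ "exp (lam\<^sup>2 * k / 2)"]) auto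
      also have "\<dots> = A k n"
        unfolding A_def by (subst X.nn_integral_fst[symmetric]) (auto intro: m)
      finally show ?thesis .
    qed
    ultimately show ?thesis by simp
  qed
  \<comment> \<open>Monotone convergence as the cap is lifted; pointwise, \<open>f k t\<close> is
    constant once \<open>k\<close> reaches t^2.\<close>
  have a_lim: "(\<lambda>k. \<integral>\<^sup>+t. ennreal (f k t) \<partial>std_normal_distribution) \<longlonglongrightarrow> ennreal (1 / sqrt (1 - lam\<^sup>2))"
  proof -
    have "(\<lambda>k. \<integral>\<^sup>+t. ennreal (f k t) \<partial>std_normal_distribution)
        \<longlonglongrightarrow> (\<integral>\<^sup>+t. ennreal (exp (lam\<^sup>2 * t\<^sup>2 / 2)) \<partial>std_normal_distribution)"
    proof (rule nn_integral_LIMSEQ)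
      show "mono (\<lambda>k t. ennreal (f k t))"
        unfolding mono_def le_fun_def f_def
        by (auto intro!: ennreal_leI mult_left_mono divide_right_mono)
      fix t :: real
      have "\<forall>\<^sub>F k in sequentially. ennreal (f k t) = ennreal (exp (lam\<^sup>2 * t\<^sup>2 / 2))"
        using eventually_ge_at_top[of "nat \<lceil>t\<^sup>2\<rceil>"]
        by eventually_elim (auto simp: f_def min_def nat_ceiling_le_eq)
      thus "(\<lambda>k. ennreal (f k t)) \<longlonglongrightarrow> ennreal (exp (lam\<^sup>2 * t\<^sup>2 / 2))"
        by (rule tendsto_eventually)
    qed simp
    thus ?thesis
      using lam(2) pos by (simp add: nn_integral_std_gaussian_exp_square power_less_one_iff)
  qed
  have "J \<longlonglongrightarrow> ennreal (1 / sqrt (1 - lam\<^sup>2))"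
  proof (rule tendsto_via_truncation[OF _ _ A_lim _ a_lim])
    show "\<forall>\<^sub>F n in sequentially. J n \<le> A k n + ennreal (exp (- (\<mu>\<^sup>2 - lam\<^sup>2) * k / 2)) * C" for k
      using eventually_gt_at_top[of 0] by eventually_elim (rule upper)
    show "\<forall>\<^sub>F n in sequentially. A k n \<le> J n + R k n" for k
      using lower by simp
    have "(\<lambda>n. 1 - measure (X n) (B n)) \<longlonglongrightarrow> 1 - 1"
      unfolding B_def X_def
      by (intro tendsto_diff tendsto_const norm_iid_prior_concentrates var pos
          subgaussian_integrable_power4[OF real_distribution_axioms sg])
    hence "(\<lambda>n. ennreal (1 - measure (X n) (B n))) \<longlonglongrightarrow> ennreal 0"
      by (intro tendsto_ennrealI) simp
    hence "R k \<longlonglongrightarrow> 2 * ennreal (exp (lam\<^sup>2 * k / 2)) * ennreal 0" for k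
      unfolding R_def by (intro ennreal_tendsto_cmult) (auto simp: ennreal_mult_less_top)
    thus "R k \<longlonglongrightarrow> 0" for k by simp
    have "(\<lambda>k. exp (- ((\<mu>\<^sup>2 - lam\<^sup>2) / 2)) ^ k) \<longlonglongrightarrow> 0"
      using sq_lt by (intro LIMSEQ_realpow_zero) auto
    hence "(\<lambda>k. exp (- ((\<mu>\<^sup>2 - lam\<^sup>2) / 2) * real k)) \<longlonglongrightarrow> 0"
      by (simp only: exp_of_nat2_mult)
    hence "(\<lambda>k. C * ennreal (exp (- ((\<mu>\<^sup>2 - lam\<^sup>2) / 2) * real k))) \<longlonglongrightarrow> C * ennreal 0"
      by (intro ennreal_tendsto_cmult tendsto_ennrealI) (auto simp: C_def)
    moreover have "ennreal (exp (- (\<mu>\<^sup>2 - lam\<^sup>2) * real k / 2)) * C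
        = C * ennreal (exp (- ((\<mu>\<^sup>2 - lam\<^sup>2) / 2) * real k))" for k
    proof -
      have "- (\<mu>\<^sup>2 - lam\<^sup>2) * real k / 2 = - ((\<mu>\<^sup>2 - lam\<^sup>2) / 2) * real k"
        by (simp add: field_simps)
      thus ?thesis by (simp only: mult.commute)
    qed
    ultimately show "(\<lambda>k. ennreal (exp (- (\<mu>\<^sup>2 - lam\<^sup>2) * real k / 2)) * C) \<longlonglongrightarrow> 0"
      by simp
    show "(\<integral>\<^sup>+t. ennreal (f k t) \<partial>std_normal_distribution) \<noteq> \<infinity>" for k
    proof -
      interpret N: real_distribution std_normal_distribution by (rule real_dist_normal_dist)
      have "(\<integral>\<^sup>+t. ennreal (f k t) \<partial>std_normal_distribution) \<le> (\<integral>\<^sup>+t. ennreal (exp (lam\<^sup>2 * k / 2)) \<partial>std_normal_distribution)"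
        using f_bound by (intro nn_integral_mono ennreal_leI) auto
      also have "\<dots> < \<infinity>" using N.emeasure_space_1 by (simp add: ennreal_mult_less_top)
      finally show ?thesis by simp
    qed
    show "R k n \<noteq> \<infinity>" for k n
      by (simp add: R_def ennreal_mult_eq_top_iff)
  qed
  thus ?thesis unfolding J_def z_sq .
qed

end

subsection \<open>Contiguity\<close>

text \<open>The zero spike has likelihood ratio 1 and inner product 0 with every \<open>x\<close>,
  so this is a case of the correlation formula.\<close>

lemma nn_integral_spike_ratio: "(\<integral>\<^sup>+Y. spike_ratio n lam x Y \<partial>GWig0 n) = 1"
proof -
  have "spike_ratio n lam (\<lambda>_. 0) Y = 1" for Y
    by (simp add: spike_ratio_def spike_shift_def gaussian_ratio_def)
  thus ?thesis
    using nn_integral_spike_ratio_mult[of n lam x "\<lambda>_. 0"] by simp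
qed

text \<open>Given a spike outside the truncation event, the conditional probability of
  \<open>A\<close> is at most 1. Inside it, normalising by a probability at most 1 can only increase
  the integral.\<close>

lemma emeasure_GWig_le_truncated:
  assumes "prob_space (X n)" and sX: "sets (X n) = sets (vec_space n)" and A: "A \<in> sets (mat_space n)"
  shows "emeasure (GWig n lam X) A \<le> emeasure (GWig n lam (truncated_prior r X)) A
    + ennreal (1 - measure (X n) {x \<in> space (X n). L2_set x {..<n} \<le> r})"
proof -
  note [measurable_cong] = sX and [measurable] = A
  interpret X: prob_space "X n" by fact
  interpret P: prob_space "GWig0 n" by (rule prob_space_GWig0)
  define B where "B = {x \<in> space (X n). L2_set x {..<n} \<le> r}"
  have B [measurable]: "B \<in> sets (X n)" unfolding B_def by measurable
  let ?\<phi> = "\<lambda>x. \<integral>\<^sup>+Y. spike_ratio n lam x Y * indicator A Y \<partial>GWig0 n"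
  have \<phi>_le: "?\<phi> x \<le> 1" for x
    unfolding nn_integral_spike_ratio[of n lam x, symmetric]
    by (intro nn_integral_mono) (simp add: indicator_def)
  have "emeasure (GWig n lam X) A = (\<integral>\<^sup>+x. ?\<phi> x \<partial>X n)"
    by (rule emeasure_GWig[of X n, OF sX A])
  also have "\<dots> \<le> (\<integral>\<^sup>+x. ?\<phi> x * indicator B x + indicator (space (X n) - B) x \<partial>X n)"
    using \<phi>_le by (intro nn_integral_mono) (simp add: indicator_def)
  also have "\<dots> = (\<integral>\<^sup>+x. ?\<phi> x * indicator B x \<partial>X n) + emeasure (X n) (space (X n) - B)"
    by (subst nn_integral_add) auto
  also have "emeasure (X n) (space (X n) - B) = ennreal (1 - measure (X n) B)"
    by (simp add: X.emeasure_eq_measure X.prob_compl)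
  also have "(\<integral>\<^sup>+x. ?\<phi> x * indicator B x \<partial>X n) \<le> (\<integral>\<^sup>+x. ?\<phi> x * indicator B x \<partial>X n) / emeasure (X n) B"
  proof (cases "emeasure (X n) B = 0")
    case False
    hence "1 / emeasure (X n) B \<ge> emeasure (X n) B / emeasure (X n) B"
      by (intro divide_right_mono_ennreal X.emeasure_le_1)
    with False have "1 \<le> 1 / emeasure (X n) B"
      by (simp add: X.emeasure_eq_measure)
    from mult_left_mono[OF this, of "\<integral>\<^sup>+x. ?\<phi> x * indicator B x \<partial>X n"] show ?thesis
      by (simp add: ennreal_times_divide)
  next
    case True
    hence "AE x in X n. x \<notin> B" by (intro AE_not_in) (auto simp: null_sets_def)
    hence "(\<integral>\<^sup>+x. ?\<phi> x * indicator B x \<partial>X n) = (\<integral>\<^sup>+x. 0 \<partial>X n)"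
      by (intro nn_integral_cong_AE) auto
    thus ?thesis by simp
  qed
  also have "(\<integral>\<^sup>+x. ?\<phi> x * indicator B x \<partial>X n) / emeasure (X n) B = (\<integral>\<^sup>+x. ?\<phi> x \<partial>truncated_prior r X n)"
    unfolding truncated_prior_def B_def[symmetric]
    by (rule nn_integral_uniform_measure[symmetric]) measurable
  also have "\<dots> = emeasure (GWig n lam (truncated_prior r X)) A"
    by (rule emeasure_GWig[of "truncated_prior r X" n, OF _ A, symmetric]) (simp add: sets_truncated_prior sX)
  finally show ?thesis by (simp add: B_def)
qed

text \<open>Where the likelihood ratio is at most \<open>c\<close>, it costs \<open>c\<close> times
  the mass under \<open>P\<close>; where it exceeds \<open>c\<close>, it is below its square divided
  by \<open>c\<close>. With second moments bounded, a large \<open>c\<close> followed by small mass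
  of \<open>A\<close> makes both terms small.\<close>

lemma emeasure_le_second_moment_RN_deriv:
  assumes "sigma_finite_measure P" and ac: "absolutely_continuous P Q" and sets: "sets Q = sets P"
    and A: "A \<in> sets P" and c: "0 < c"
  shows "emeasure Q A \<le> ennreal c * emeasure P A + ennreal (1 / c) * (\<integral>\<^sup>+x. (RN_deriv P Q x)\<^sup>2 \<partial>P)"
proof -
  interpret sigma_finite_measure P by fact
  have pointwise: "l \<le> ennreal c + ennreal (1 / c) * l\<^sup>2" for l :: ennreal
  proof (cases "l \<le> ennreal c")
    case False
    have "l = ennreal (1 / c) * ennreal c * l"
      using c by (simp flip: ennreal_mult)
    also have "\<dots> \<le> ennreal (1 / c) * l * l"
      using False by (intro mult_mono) auto
    finally show ?thesis by (simp add: power2_eq_square mult.assoc add_increasing)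
  qed (simp add: add_increasing2)
  have "emeasure Q A = emeasure (density P (RN_deriv P Q)) A"
    by (simp add: density_RN_deriv[OF ac sets])
  also have "\<dots> = (\<integral>\<^sup>+x. RN_deriv P Q x * indicator A x \<partial>P)"
    using A by (simp add: emeasure_density)
  also have "\<dots> \<le> (\<integral>\<^sup>+x. ennreal c * indicator A x + ennreal (1 / c) * (RN_deriv P Q x)\<^sup>2 \<partial>P)"
    using pointwise by (intro nn_integral_mono) (simp add: indicator_def)
  also have "\<dots> = ennreal c * emeasure P A + ennreal (1 / c) * (\<integral>\<^sup>+x. (RN_deriv P Q x)\<^sup>2 \<partial>P)"
    using A by (simp add: nn_integral_add nn_integral_cmult)
  finally show ?thesis .
qed

text \<open>Separates the normalisation of a conditioned pair from the unnormalised double integral,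
  whose limit is computed on its own.\<close>

lemma nn_integral_uniform_measure_pair:
  assumes [measurable]: "B \<in> sets M" "case_prod K \<in> borel_measurable (M \<Otimes>\<^sub>M M)"
    and "sigma_finite_measure M"
  shows "(\<integral>\<^sup>+x. \<integral>\<^sup>+y. K x y \<partial>uniform_measure M B \<partial>uniform_measure M B)
    = (\<integral>\<^sup>+x. (\<integral>\<^sup>+y. K x y * indicator B y \<partial>M) * indicator B x \<partial>M)
      * (inverse (emeasure M B) * inverse (emeasure M B))"
proof -
  interpret sigma_finite_measure M by fact
  have "(\<integral>\<^sup>+x. \<integral>\<^sup>+y. K x y \<partial>uniform_measure M B \<partial>uniform_measure M B)
      = (\<integral>\<^sup>+x. (\<integral>\<^sup>+y. K x y * indicator B y \<partial>M) / emeasure M B \<partial>uniform_measure M B)"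
    by (intro nn_integral_cong nn_integral_uniform_measure) auto
  also have "\<dots> = (\<integral>\<^sup>+x. (\<integral>\<^sup>+y. K x y * indicator B y \<partial>M) / emeasure M B * indicator B x \<partial>M) / emeasure M B"
    by (rule nn_integral_uniform_measure) measurable
  also have "(\<integral>\<^sup>+x. (\<integral>\<^sup>+y. K x y * indicator B y \<partial>M) / emeasure M B * indicator B x \<partial>M)
      = (\<integral>\<^sup>+x. (\<integral>\<^sup>+y. K x y * indicator B y \<partial>M) * indicator B x \<partial>M) * inverse (emeasure M B)"
    by (subst nn_integral_multc[symmetric]) (auto simp: divide_ennreal_def mult_ac)
  finally show ?thesis by (simp add: divide_ennreal_def mult.assoc)
qed

text \<open>Absolute continuity makes \<open>RN_deriv\<close> a genuine density of
  \<open>Q' n\<close>, and \<open>0 < 1 - lam\<^sup>2\<close> gives the limit its intended value.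
  Where the truncation event has probability zero, \<open>Q' n\<close> is the null measure; this can
  happen for finitely many \<open>n\<close> only.\<close>

theorem theorem3p10:
  fixes \<pi> :: "real measure" and \<sigma> \<delta> lam :: real
    and X X' :: "nat \<Rightarrow> (nat \<Rightarrow> real) measure"
    and P Q Q' :: "nat \<Rightarrow> (nat \<times> nat \<Rightarrow> real) measure"
  defines "X \<equiv> iid_prior \<pi>"
    and "X' \<equiv> truncated_prior (1 + \<delta>) X"
    and "P \<equiv> \<lambda>n. GWig0 n"
    and "Q \<equiv> \<lambda>n. GWig n lam X"
    and "Q' \<equiv> \<lambda>n. GWig n lam X'"
  assumes "real_distribution \<pi>"
    and "integrable \<pi> (\<lambda>t. t)" and "prob_space.expectation \<pi> (\<lambda>t. t) = 0"
    and "integrable \<pi> (\<lambda>t. t\<^sup>2)" and "prob_space.variance \<pi> (\<lambda>t. t) = 1"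
    and "lam \<ge> 0"
    and "\<sigma> > 0" and "subgaussian \<pi> (\<lambda>t. t) (\<sigma>\<^sup>2)"
    and "lam < 1 / \<sigma>"
    and "\<delta> > 0" and "lam < 1 / (\<sigma> * (1 + \<delta>))"
  shows "(\<lambda>n. measure (X n) {x \<in> space (X n). L2_set x {..<n} \<le> 1 + \<delta>}) \<longlonglongrightarrow> 1
    \<and> (\<forall>n. absolutely_continuous (P n) (Q' n))
    \<and> (\<lambda>n. \<integral>\<^sup>+ Y. (RN_deriv (P n) (Q' n) Y)\<^sup>2 \<partial>P n) \<longlonglongrightarrow> ennreal ((1 - lam\<^sup>2) powr (- 1 / 2))
    \<and> 0 < 1 - lam\<^sup>2
    \<and> contiguous Q P"
proof -
  have \<pi>: "real_distribution \<pi>" by fact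
  interpret \<pi>: real_distribution \<pi> by fact
  have var: "\<pi>.expectation (\<lambda>t. t\<^sup>2) = 1"
    using \<open>\<pi>.expectation (\<lambda>t. t) = 0\<close> \<open>\<pi>.variance (\<lambda>t. t) = 1\<close> by simp
  note sg = \<open>subgaussian \<pi> (\<lambda>t. t) (\<sigma>\<^sup>2)\<close> and lam0 = \<open>0 \<le> lam\<close>
  \<comment> \<open>Comparing variance proxy with variance turns \<open>lam < 1 / \<sigma>\<close>
    into \<open>lam < 1\<close>, which makes the limit finite.\<close>
  have "1 \<le> \<sigma>\<^sup>2"
    using subgaussian_unit_variance_ge_1[OF \<pi> sg \<open>integrable \<pi> (\<lambda>t. t\<^sup>2)\<close> var] .
  hence "1 \<le> \<sigma>" using \<open>\<sigma> > 0\<close> power2_le_imp_le[of 1 \<sigma>] by simp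
  hence "1 / \<sigma> \<le> 1" by simp
  hence lam1: "lam < 1" using \<open>lam < 1 / \<sigma>\<close> by linarith
  hence lam_sq: "0 < 1 - lam\<^sup>2" using lam0 by (simp add: power_less_one_iff)
  have lam_r: "lam * \<sigma> * (1 + \<delta>) < 1"
    using \<open>lam < 1 / (\<sigma> * (1 + \<delta>))\<close> \<open>\<sigma> > 0\<close> \<open>\<delta> > 0\<close>
    by (subst (asm) pos_less_divide_eq) (auto simp: mult.assoc)
  define L where "L = (1 - lam\<^sup>2) powr (- 1 / 2)"
  have L: "L = 1 / sqrt (1 - lam\<^sup>2)"
    using lam_sq by (simp add: L_def powr_minus_divide powr_half_sqrt)
  define B where "B n = {x \<in> space (X n). L2_set x {..<n} \<le> 1 + \<delta>}" for n
  have psX: "prob_space (X n)" for n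
    unfolding X_def by (rule prob_space_iid_prior[OF \<pi>])
  have sX: "sets (X n) = sets (vec_space n)" for n
    by (simp add: X_def sets_iid_prior)
  note [measurable_cong] = sX
  have Bm [measurable]: "B n \<in> sets (X n)" for n unfolding B_def by measurable
  have fX': "finite_measure (X' n)" for n
    unfolding X'_def by (rule finite_measure_truncated_prior[of X n, OF psX Bm[unfolded B_def]])
  have sX': "sets (X' n) = sets (vec_space n)" for n
    by (simp add: X'_def sets_truncated_prior sX)
  have B_lim: "(\<lambda>n. measure (X n) (B n)) \<longlonglongrightarrow> 1"
    unfolding B_def X_def
    by (rule \<pi>.norm_iid_prior_concentrates[OF _ var subgaussian_integrable_power4[OF \<pi> sg]]) (use assms in simp_all)
  have ac: "absolutely_continuous (P n) (Q' n)" for n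
    unfolding P_def Q'_def by (rule absolutely_continuous_GWig[of X' n, OF fX' sX'])
  define S where "S n = (\<integral>\<^sup>+Y. (RN_deriv (P n) (Q' n) Y)\<^sup>2 \<partial>P n)" for n
  define J where "J n = (\<integral>\<^sup>+x. (\<integral>\<^sup>+y. ennreal (exp (real n * lam\<^sup>2 / 2 * (\<Sum>i<n. x i * y i)\<^sup>2)) * indicator (B n) y \<partial>X n)
      * indicator (B n) x \<partial>X n)" for n
  have S_eq: "S n = J n * (inverse (ennreal (measure (X n) (B n))) * inverse (ennreal (measure (X n) (B n))))" for n
  proof -
    interpret X: prob_space "X n" by (rule psX)
    have m: "(\<lambda>p. ennreal (exp (real n * lam\<^sup>2 / 2 * (\<Sum>i<n. fst p i * snd p i)\<^sup>2))) \<in> borel_measurable (X n \<Otimes>\<^sub>M X n)"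
      by measurable
    have "S n = (\<integral>\<^sup>+x. \<integral>\<^sup>+y. ennreal (exp (real n * lam\<^sup>2 / 2 * (\<Sum>i<n. x i * y i)\<^sup>2)) \<partial>X' n \<partial>X' n)"
      unfolding S_def P_def Q'_def by (rule nn_integral_RN_deriv_GWig_square[of X' n, OF fX' sX'])
    also have "\<dots> = J n * (inverse (emeasure (X n) (B n)) * inverse (emeasure (X n) (B n)))"
      unfolding X'_def truncated_prior_def B_def[symmetric] J_def
      by (rule nn_integral_uniform_measure_pair) (use m X.sigma_finite_measure_axioms in \<open>auto simp: case_prod_unfold\<close>)
    finally show ?thesis by (simp add: X.emeasure_eq_measure)
  qed
  have J_lim: "J \<longlonglongrightarrow> ennreal L"
    unfolding J_def B_def X_def L
    by (rule \<pi>.truncated_second_moment_limit[OF _ _ _ var sg]) (use assms lam_r lam1 in simp_all)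
  have inv_lim: "(\<lambda>n. inverse (ennreal (measure (X n) (B n)))) \<longlonglongrightarrow> 1"
  proof -
    have lim: "(\<lambda>n. ennreal (measure (X n) (B n))) \<longlonglongrightarrow> ennreal 1"
      by (intro tendsto_ennrealI B_lim)
    \<comment> \<open>Inversion is continuous on all of \<open>ennreal\<close>, including 0, so
      indices where \<open>B n\<close> has probability zero need no separate treatment.\<close>
    have "continuous_on UNIV (inverse :: ennreal \<Rightarrow> ennreal)"
      using continuous_on_inverse_ennreal[OF continuous_on_id] .
    from continuous_on_tendsto_compose[OF this lim]
    have "(\<lambda>n. inverse (ennreal (measure (X n) (B n)))) \<longlonglongrightarrow> inverse (ennreal 1)" by simp
    thus ?thesis by simp
  qed
  have "S \<longlonglongrightarrow> ennreal L * (1 * 1)"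
    unfolding S_eq by (intro tendsto_mult_ennreal J_lim inv_lim) auto
  hence S_lim: "S \<longlonglongrightarrow> ennreal L" by simp
  have contig: "contiguous Q P"
    unfolding contiguous_def
  proof (intro conjI allI impI)
    show "sets (Q n) = sets (P n)" for n by (simp add: Q_def P_def)
    fix A assume A: "\<forall>n. A n \<in> sets (P n)" and lim: "(\<lambda>n. measure (P n) (A n)) \<longlonglongrightarrow> 0"
    have psP: "prob_space (P n)" for n unfolding P_def by (rule prob_space_GWig0)
    have psQ: "prob_space (Q n)" for n unfolding Q_def by (rule prob_space_GWig[of X n, OF psX sX])
    have le: "emeasure (Q n) (A n)
        \<le> ennreal c * ennreal (measure (P n) (A n)) + ennreal (1 / c) * S n + ennreal (1 - measure (X n) (B n))"
      if "0 < c" for c n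
    proof -
      interpret P: prob_space "P n" by (rule psP)
      have "A n \<in> sets (mat_space n)" using A by (simp add: P_def)
      from emeasure_GWig_le_truncated[of X n, OF psX sX this, of lam "1 + \<delta>"]
      have "emeasure (Q n) (A n) \<le> emeasure (Q' n) (A n) + ennreal (1 - measure (X n) (B n))"
        by (simp add: Q_def Q'_def X'_def B_def)
      also have "emeasure (Q' n) (A n) \<le> ennreal c * emeasure (P n) (A n) + ennreal (1 / c) * S n"
        unfolding S_def using A that
        by (intro emeasure_le_second_moment_RN_deriv ac P.sigma_finite_measure_axioms)
           (auto simp: Q'_def P_def)
      finally show ?thesis by (simp add: P.emeasure_eq_measure add_right_mono)
    qed
    have "(\<lambda>n. emeasure (Q n) (A n)) \<longlonglongrightarrow> 0"
    proof (rule order_tendstoI)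
      fix u :: ennreal assume "0 < u"
      \<comment> \<open>The cutoff \<open>c = Suc k\<close> is chosen large enough that the limiting
        second moment divided by it is below \<open>u\<close>; with \<open>c\<close> then fixed, the
        other two terms vanish as \<open>n\<close> grows.\<close>
      have "(\<lambda>k. ennreal (1 / real (Suc k) * L)) \<longlonglongrightarrow> ennreal (0 * L)"
        by (intro tendsto_ennrealI tendsto_mult tendsto_const LIMSEQ_Suc lim_1_over_n)
      with \<open>0 < u\<close> have "\<forall>\<^sub>F k in sequentially. ennreal (1 / real (Suc k) * L) < u"
        by (intro order_tendstoD(2)) auto
      then obtain k where k: "ennreal (1 / real (Suc k) * L) < u"
        by (auto simp: eventually_sequentially)
      let ?c = "real (Suc k)"
      have lim_B: "(\<lambda>n. ennreal (1 - measure (X n) (B n))) \<longlonglongrightarrow> ennreal (1 - 1)"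
        by (intro tendsto_ennrealI tendsto_diff tendsto_const B_lim)
      have "(\<lambda>n. ennreal ?c * ennreal (measure (P n) (A n)) + ennreal (1 / ?c) * S n + ennreal (1 - measure (X n) (B n)))
          \<longlonglongrightarrow> ennreal ?c * ennreal 0 + ennreal (1 / ?c) * ennreal L + ennreal (1 - 1)"
        by (intro tendsto_add ennreal_tendsto_cmult tendsto_ennrealI[OF lim] S_lim lim_B) auto
      moreover have "ennreal ?c * ennreal 0 + ennreal (1 / ?c) * ennreal L + ennreal (1 - 1) = ennreal (1 / ?c * L)"
        by (simp add: ennreal_mult[symmetric] L_def del: of_nat_Suc)
      ultimately have "\<forall>\<^sub>F n in sequentially.
          ennreal ?c * ennreal (measure (P n) (A n)) + ennreal (1 / ?c) * S n + ennreal (1 - measure (X n) (B n)) < u"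
        using k by (intro order_tendstoD(2)) (simp_all only:)
      thus "\<forall>\<^sub>F n in sequentially. emeasure (Q n) (A n) < u"
      proof eventually_elim
        case (elim n)
        show ?case by (rule le_less_trans[OF le elim]) simp
      qed
    qed simp
    moreover have "emeasure (Q n) (A n) = ennreal (measure (Q n) (A n))" for n
      using prob_space.finite_measure[OF psQ] by (simp add: finite_measure.emeasure_eq_measure)
    ultimately show "(\<lambda>n. measure (Q n) (A n)) \<longlonglongrightarrow> 0"
      by (simp add: ennreal_tendsto_0_iff)
  qed
  show ?thesis
    using B_lim ac S_lim lam_sq contig unfolding B_def S_def L_def by blast
qed

end
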